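(* Let $G$ be a finite non-abelian group and let $\Gamma_G$ be its commuting graph. If $G$ is not isomorphic to the symmetric group $S_4$ of degree $4$ and $\Gamma_G$ is planar, then $\Gamma_G$ is integral.
   Context: For a finite non-abelian group $G$ with centre $Z(G)$, the commuting graph $\Gamma_G$ is the simple undirected graph with vertex set $G\setminus Z(G)$ in which two distinct vertices $x,y$ are adjacent if and only if $xy=yx$. A graph is integral if all eigenvalues of its adjacency matrix are integers. The genus of a graph is the smallest non-negative integer $n$ such that the graph can be embedded on the surface obtained by attaching $n$ handles to a sphere; a graph is planar if its genus is $0$. *)

theory Defs
  imports
    "HOL-Analysis.Analysis"
    "HOL-Algebra.Sym_Groups"
    "HOL-Library.Extended_Nat"
    "Jordan_Normal_Form.Char_Poly"
begin

section \<open>Simple graphs and the commuting graph\<close>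

record 'a sgraph =
  verts :: "'a set"
  edges :: "'a set set"

definition group_center :: "('a, 'b) monoid_scheme \<Rightarrow> 'a set" where
  "group_center G = {z \<in> carrier G. \<forall>g \<in> carrier G. z \<otimes>\<^bsub>G\<^esub> g = g \<otimes>\<^bsub>G\<^esub> z}"

definition commuting_graph :: "('a, 'b) monoid_scheme \<Rightarrow> 'a sgraph" where
  "commuting_graph G =
     \<lparr> verts = carrier G - group_center G,
       edges = {{x, y} | x y. x \<in> carrier G - group_center G \<and> y \<in> carrier G - group_center G
                  \<and> x \<noteq> y \<and> x \<otimes>\<^bsub>G\<^esub> y = y \<otimes>\<^bsub>G\<^esub> x} \<rparr>"


section \<open>Integral graphs\<close>

definition adjacency_matrix :: "'a sgraph \<Rightarrow> 'a list \<Rightarrow> complex mat" where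
  "adjacency_matrix \<Gamma> vs =
     mat (length vs) (length vs) (\<lambda>(i, j). if {vs ! i, vs ! j} \<in> edges \<Gamma> then 1 else 0)"

text \<open>
  The list \<open>vs\<close> enumerates the vertices without repetition.  Changing the enumeration conjugates
  the adjacency matrix by a permutation matrix, so the eigenvalues do not depend on it.
\<close>
definition integral_graph :: "'a sgraph \<Rightarrow> bool" where
  "integral_graph \<Gamma> \<longleftrightarrow> finite (verts \<Gamma>) \<and>
     (\<forall>vs. distinct vs \<and> set vs = verts \<Gamma> \<longrightarrow>
        (\<forall>k. eigenvalue (adjacency_matrix \<Gamma> vs) k \<longrightarrow> k \<in> \<int>))"


section \<open>Genus and planarity\<close>

text \<open>
  Surfaces are realised as subsets of three-dimensional Euclidean space, starting from the unit
  sphere.  To attach a handle, remove the interiors of two disjoint closed discs \<open>f1\<close>, \<open>f2\<close> of the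
  surface and glue in a cylinder \<open>h\<close> along the two boundary circles.  All maps involved are
  injective and continuous on compact sets, hence homeomorphisms onto their images.  There is no
  condition on the sense in which the circles are glued: a closed surface in three-space is
  orientable, which rules out the non-orientable way of attaching the cylinder.
\<close>
inductive sphere_with_handles :: "nat \<Rightarrow> (real^3) set \<Rightarrow> bool" where
  unit_sphere: "sphere_with_handles 0 (sphere 0 1)"
| attach_handle: "sphere_with_handles (Suc n) (R \<union> h ` (sphere 0 1 \<times> {0..1}))"
  if "sphere_with_handles n S"
    and "continuous_on (cball (0::complex) 1) f1" "inj_on f1 (cball 0 1)" "f1 ` cball 0 1 \<subseteq> S"
    and "continuous_on (cball (0::complex) 1) f2" "inj_on f2 (cball 0 1)" "f2 ` cball 0 1 \<subseteq> S"
    and "f1 ` cball 0 1 \<inter> f2 ` cball 0 1 = {}"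
    and "R = S - (f1 ` ball 0 1 \<union> f2 ` ball 0 1)"
    and "continuous_on (sphere (0::complex) 1 \<times> {0..1::real}) h"
    and "inj_on h (sphere 0 1 \<times> {0..1})"
    and "h ` (sphere 0 1 \<times> {0}) = f1 ` sphere 0 1"
    and "h ` (sphere 0 1 \<times> {1}) = f2 ` sphere 0 1"
    and "h ` (sphere 0 1 \<times> {0<..<1}) \<inter> R = {}"

text \<open>
  Vertices are drawn as distinct points and an edge as a simple arc joining its two endpoints; an
  arc contains no other vertex, and two arcs meet only in common endpoints.
\<close>
definition embeddable_on :: "'a sgraph \<Rightarrow> 'b::topological_space set \<Rightarrow> bool" where
  "embeddable_on \<Gamma> S \<longleftrightarrow>
     (\<exists>(\<phi> :: 'a \<Rightarrow> 'b) (\<gamma> :: 'a set \<Rightarrow> real \<Rightarrow> 'b).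
        inj_on \<phi> (verts \<Gamma>) \<and> \<phi> ` verts \<Gamma> \<subseteq> S \<and>
        (\<forall>e \<in> edges \<Gamma>. arc (\<gamma> e) \<and> path_image (\<gamma> e) \<subseteq> S \<and>
           {pathstart (\<gamma> e), pathfinish (\<gamma> e)} = \<phi> ` e \<and>
           path_image (\<gamma> e) \<inter> \<phi> ` verts \<Gamma> = \<phi> ` e) \<and>
        (\<forall>e \<in> edges \<Gamma>. \<forall>e' \<in> edges \<Gamma>. e \<noteq> e' \<longrightarrow>
           path_image (\<gamma> e) \<inter> path_image (\<gamma> e') = \<phi> ` (e \<inter> e')))"

text \<open>
  The infimum is taken in \<open>enat\<close> so that it is meaningful without first showing that the graph
  embeds on some surface (the infimum of the empty set is \<open>\<infinity>\<close>); of a nonempty set it is the minimum.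
\<close>
definition graph_genus :: "'a sgraph \<Rightarrow> enat" where
  "graph_genus \<Gamma> = Inf {enat n | n. \<exists>S. sphere_with_handles n S \<and> embeddable_on \<Gamma> S}"

definition planar_graph :: "'a sgraph \<Rightarrow> bool" where
  "planar_graph \<Gamma> \<longleftrightarrow> graph_genus \<Gamma> = 0"

end

theory Submission
  imports Defs "HOL-Algebra.Sylow" "HOL-Algebra.Multiplicative_Group"
begin

text \<open>
  A planar graph contains no \<open>K\<^sub>5\<close>, so at most four noncentral elements of \<open>G\<close> commute pairwise. If
  commuting is transitive on the noncentral elements, the commuting graph is a disjoint union of
  cliques, with eigenvalues \<open>-1\<close> and \<open>n - 1\<close> for the clique sizes \<open>n\<close>. If the centre is nontrivial and
  \<open>x\<close>, \<open>y\<close> are noncentral and commute, five elements among the cosets of \<open>x\<close>, \<open>y\<close>, \<open>xy\<close> modulo the centre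
  give a contradiction unless two of the cosets \<open>Z\<close>, \<open>Zx\<close>, \<open>Zy\<close>, \<open>Zxy\<close> coincide, whence transitivity.
  If the centre is trivial and transitivity fails, some involution \<open>x\<^sub>0\<close> has a nonabelian centralizer;
  that centralizer has order 8, its index is odd, and counting conjugacy classes modulo 2, 3 and 5
  leaves only the order 24. Then the action on the four pairs \<open>{q, inv q}\<close> of elements of order 3
  identifies \<open>G\<close> with \<open>S\<^sub>4\<close>.

  For the nonplanarity of \<open>K\<^sub>5\<close>, let \<open>d\<close>, \<open>e\<close> be the vertices off a triangle \<open>abc\<close>. Stereographic projection
  from \<open>d\<close> and the Jordan curve theorem provide a point on the side of the triangle that avoids the
  whole drawing; projecting from this point puts \<open>d\<close> and \<open>e\<close> inside the triangle, and the theta-curve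
  theorem shows that \<open>e\<close> is cut off from one of \<open>a\<close>, \<open>b\<close>, \<open>c\<close>.
\<close>

section \<open>Disjoint unions of cliques\<close>

text \<open>Read at a vertex, the eigenvalue equation says that the entries of an eigenvector over
  the closed neighbourhood sum to \<open>k + 1\<close> times the entry at that vertex. Within a
  clique all closed neighbourhoods agree, so for \<open>k \<noteq> -1\<close> the entries on a
  clique agree too, and a nonzero one forces \<open>k + 1\<close> to be the clique size.\<close>

lemma integral_cluster_graph:
  assumes fin: "finite (verts \<Gamma>)"
    and loopless: "\<And>x. {x} \<notin> edges \<Gamma>"
    and trans: "\<And>x y z. \<lbrakk>{x, y} \<in> edges \<Gamma>; {y, z} \<in> edges \<Gamma>; x \<noteq> z\<rbrakk> \<Longrightarrow> {x, z} \<in> edges \<Gamma>"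
  shows "integral_graph \<Gamma>"
  unfolding integral_graph_def
proof (intro conjI allI impI fin)
  fix vs k
  assume vs: "distinct vs \<and> set vs = verts \<Gamma>" and ev: "eigenvalue (adjacency_matrix \<Gamma> vs) k"
  define n where "n = length vs"
  define A where "A = adjacency_matrix \<Gamma> vs"
  have A: "A \<in> carrier_mat n n" by (simp add: A_def adjacency_matrix_def n_def)
  from ev obtain v where v: "v \<in> carrier_vec n" "v \<noteq> 0\<^sub>v n" and Av: "A *\<^sub>v v = k \<cdot>\<^sub>v v"
    using A unfolding eigenvalue_def eigenvector_def A_def[symmetric] by auto
  \<comment> \<open>The indices of the closed neighbourhood of \<open>vs ! i\<close>; transitivity
    makes this the whole clique of \<open>vs ! i\<close>.\<close>
  define C where "C i = {j. j < n \<and> (j = i \<or> {vs ! i, vs ! j} \<in> edges \<Gamma>)}" for i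
  have finC: "finite (C i)" for i by (simp add: C_def)
  have sumC: "(\<Sum>j\<in>C i. vec_index v j) = (k + 1) * (vec_index v i)" if i: "i < n" for i
  proof -
    have "k * (vec_index v i) = vec_index (A *\<^sub>v v) i"
      using Av v i by simp
    also have "\<dots> = (\<Sum>j\<in>{0..<n}. (if {vs ! i, vs ! j} \<in> edges \<Gamma> then 1 else 0) * (vec_index v j))"
      using A v i by (auto simp: scalar_prod_def A_def adjacency_matrix_def n_def intro!: sum.cong)
    also have "\<dots> = (\<Sum>j\<in>{j\<in>{0..<n}. {vs ! i, vs ! j} \<in> edges \<Gamma>}. vec_index v j)"
      by (subst sum.inter_filter) (auto intro!: sum.cong)
    also have "{j\<in>{0..<n}. {vs ! i, vs ! j} \<in> edges \<Gamma>} = C i - {i}"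
      using loopless by (auto simp: C_def)
    finally have "(\<Sum>j\<in>C i - {i}. vec_index v j) = k * (vec_index v i)" by simp
    moreover have "i \<in> C i" using i by (simp add: C_def)
    ultimately show ?thesis using finC by (simp add: sum.remove algebra_simps)
  qed
  have C_eq: "C j = C i" if "i < n" "j \<in> C i" for i j
  proof -
    have *: "C j \<subseteq> C i" if "i < n" "j \<in> C i" for i j
    proof
      fix l assume "l \<in> C j"
      then show "l \<in> C i"
        using that trans[of "vs ! i" "vs ! j" "vs ! l"] vs
        by (cases "i = l") (auto simp: C_def n_def nth_eq_iff_index_eq)
    qed
    from that have "i \<in> C j" "j < n" by (auto simp: C_def insert_commute)
    then show ?thesis using that * by blast
  qed
  show "k \<in> \<int>"
  proof (cases "k = -1")
    case False
    obtain i where i: "i < n" "vec_index v i \<noteq> 0" using v by (metis carrier_vecD eq_vecI index_zero_vec(1,2))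
    have "vec_index v j = vec_index v i" if j: "j \<in> C i" for j
    proof -
      have "j < n" using j by (simp add: C_def)
      then have "(k + 1) * (vec_index v j) = (k + 1) * (vec_index v i)"
        using sumC C_eq[OF i(1) j] i(1) by metis
      with False show ?thesis by (simp add: eq_neg_iff_add_eq_0)
    qed
    then have "of_nat (card (C i)) * (vec_index v i) = (k + 1) * (vec_index v i)"
      using sumC[OF i(1)] by simp
    then have "k + 1 = of_nat (card (C i))" using i by simp
    then have "k = of_nat (card (C i)) - 1" by (simp add: eq_diff_eq)
    then show ?thesis by simp
  qed simp
qed

section \<open>Nonplanarity of \<open>K\<^sub>5\<close>\<close>

text \<open>Arcs are indexed by ordered pairs, with \<open>g u v\<close> and \<open>g v u\<close>
  sharing only their image, so that paths through several vertices can be composed with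
  \<open>+++\<close>. The target space is left open because the same drawing occurs on the sphere
  and, after projection, in the plane.\<close>

locale complete_drawing =
  fixes V :: "'v set" and \<phi> :: "'v \<Rightarrow> 't::topological_space" and g :: "'v \<Rightarrow> 'v \<Rightarrow> real \<Rightarrow> 't"
  assumes inj: "inj_on \<phi> V"
    and arc: "\<And>u v. \<lbrakk>u \<in> V; v \<in> V; u \<noteq> v\<rbrakk> \<Longrightarrow> arc (g u v)"
    and start [simp]: "\<And>u v. \<lbrakk>u \<in> V; v \<in> V; u \<noteq> v\<rbrakk> \<Longrightarrow> pathstart (g u v) = \<phi> u"
    and finish [simp]: "\<And>u v. \<lbrakk>u \<in> V; v \<in> V; u \<noteq> v\<rbrakk> \<Longrightarrow> pathfinish (g u v) = \<phi> v"
    and sym: "\<And>u v. \<lbrakk>u \<in> V; v \<in> V; u \<noteq> v\<rbrakk> \<Longrightarrow> path_image (g u v) = path_image (g v u)"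
    and vertices: "\<And>u v. \<lbrakk>u \<in> V; v \<in> V; u \<noteq> v\<rbrakk> \<Longrightarrow> path_image (g u v) \<inter> \<phi> ` V = {\<phi> u, \<phi> v}"
    and crossing: "\<And>u v w x. \<lbrakk>u \<in> V; v \<in> V; u \<noteq> v; w \<in> V; x \<in> V; w \<noteq> x; {u, v} \<noteq> {w, x}\<rbrakk>
        \<Longrightarrow> path_image (g u v) \<inter> path_image (g w x) = \<phi> ` ({u, v} \<inter> {w, x})"
begin

definition E :: "'v \<Rightarrow> 'v \<Rightarrow> 't set" where
  "E u v = path_image (g u v)"

lemma E_sym: "\<lbrakk>u \<in> V; v \<in> V; u \<noteq> v\<rbrakk> \<Longrightarrow> E u v = E v u"
  unfolding E_def by (rule sym)

lemma E_connected: "\<lbrakk>u \<in> V; v \<in> V; u \<noteq> v\<rbrakk> \<Longrightarrow> connected (E u v)"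
  unfolding E_def using arc arc_imp_path connected_path_image by blast

lemma E_ends: "\<lbrakk>u \<in> V; v \<in> V; u \<noteq> v\<rbrakk> \<Longrightarrow> \<phi> u \<in> E u v" "\<lbrakk>u \<in> V; v \<in> V; u \<noteq> v\<rbrakk> \<Longrightarrow> \<phi> v \<in> E u v"
  unfolding E_def using pathstart_in_path_image pathfinish_in_path_image start finish by metis+

lemma E_vertex: "\<lbrakk>u \<in> V; v \<in> V; u \<noteq> v; w \<in> V; w \<noteq> u; w \<noteq> v\<rbrakk> \<Longrightarrow> \<phi> w \<notin> E u v"
  using vertices[of u v] inj by (auto simp: E_def inj_on_def)

lemma \<phi>_eq: "\<lbrakk>u \<in> V; v \<in> V\<rbrakk> \<Longrightarrow> \<phi> u = \<phi> v \<longleftrightarrow> u = v"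
  using inj by (auto simp: inj_on_def)

lemma E_disjoint:
  assumes "u \<in> V" "v \<in> V" "w \<in> V" "x \<in> V" "distinct [u, v, w, x]"
  shows "E u v \<inter> E w x = {}"
proof -
  have "{u, v} \<inter> {w, x} = {}" "{u, v} \<noteq> {w, x}" using assms by auto
  then show ?thesis using crossing[of u v w x] assms by (simp add: E_def)
qed

lemma E_meet:
  assumes "u \<in> V" "v \<in> V" "w \<in> V" "distinct [u, v, w]"
  shows "E u v \<inter> E u w = {\<phi> u}"
proof -
  have "{u, v} \<inter> {u, w} = {u}" "{u, v} \<noteq> {u, w}" using assms by auto
  then show ?thesis using crossing[of u v u w] assms by (simp add: E_def)
qed

text \<open>By injectivity the arc loses only the parameter 1, and the half-open interval that
  remains is connected.\<close>

lemma E_minus_finish: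
  assumes "u \<in> V" "v \<in> V" "u \<noteq> v"
  shows "connected (E u v - {\<phi> v})"
proof -
  have a: "arc (g u v)" and f: "g u v 1 = \<phi> v"
    using arc finish assms by (auto simp: pathfinish_def)
  have "E u v - {\<phi> v} = g u v ` {0..<1}"
  proof -
    have "{0..1::real} - {1} = {0..<1}" by auto
    then show ?thesis
      using a inj_on_image_set_diff[of "g u v" "{0..1}" "{0..1}" "{1}"]
      by (auto simp: E_def path_image_def arc_def f)
  qed
  moreover have "continuous_on {0..<1} (g u v)"
    using a unfolding arc_def path_def by (rule conjE) (erule continuous_on_subset, auto)
  ultimately show ?thesis
    using connected_continuous_image[of "{0..<1::real}" "g u v"] by simp
qed

lemma E_minus_start:
  "\<lbrakk>u \<in> V; v \<in> V; u \<noteq> v\<rbrakk> \<Longrightarrow> connected (E u v - {\<phi> u})"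
  using E_minus_finish[of v u] E_sym[of u v] by simp

text \<open>Carries a drawing from the punctured sphere to the plane. Injectivity on
  \<open>S\<close> turns intersections of images into images of intersections.\<close>

lemma transfer:
  assumes "homeomorphism S T h k" "\<phi> ` V \<subseteq> S"
    and "\<And>u v. \<lbrakk>u \<in> V; v \<in> V; u \<noteq> v\<rbrakk> \<Longrightarrow> path_image (g u v) \<subseteq> S"
  shows "complete_drawing V (h \<circ> \<phi>) (\<lambda>u v. h \<circ> g u v)"
proof
  have hinj: "inj_on h S" and hc: "continuous_on S h"
    using assms(1) by (auto simp: homeomorphism_def inj_on_def) metis
  have im: "h ` A \<inter> h ` B = h ` (A \<inter> B)" if "A \<subseteq> S" "B \<subseteq> S" for A B
    using inj_on_image_Int[OF hinj that] by simp
  show "inj_on (h \<circ> \<phi>) V"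
    using comp_inj_on[OF inj] inj_on_subset[OF hinj assms(2)] by blast
  fix u v assume uv: "u \<in> V" "v \<in> V" "u \<noteq> v"
  show "arc (h \<circ> g u v)"
    using arc[OF uv] assms(3)[OF uv] hinj hc
    by (auto simp: arc_def path_image_def intro!: path_continuous_image comp_inj_on
        intro: continuous_on_subset inj_on_subset)
  show "pathstart (h \<circ> g u v) = (h \<circ> \<phi>) u" "pathfinish (h \<circ> g u v) = (h \<circ> \<phi>) v"
    using uv by (simp_all add: pathstart_compose pathfinish_compose)
  show "path_image (h \<circ> g u v) = path_image (h \<circ> g v u)"
    using sym[OF uv] by (simp add: path_image_compose)
  show "path_image (h \<circ> g u v) \<inter> (h \<circ> \<phi>) ` V = {(h \<circ> \<phi>) u, (h \<circ> \<phi>) v}"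
    using im[OF assms(3)[OF uv] assms(2)] vertices[OF uv]
    by (simp add: path_image_compose image_image)
  fix w x assume wx: "w \<in> V" "x \<in> V" "w \<noteq> x" "{u, v} \<noteq> {w, x}"
  show "path_image (h \<circ> g u v) \<inter> path_image (h \<circ> g w x) = (h \<circ> \<phi>) ` ({u, v} \<inter> {w, x})"
    using im[OF assms(3)[OF uv] assms(3)[OF wx(1-3)]] crossing[OF uv wx]
    by (simp add: path_image_compose image_comp)
qed

end

section \<open>The plane: theta curves and subdivided triangles\<close>

lemma connected_subset_inside:
  assumes "connected K" "K \<inter> B = {}" "x \<in> K" "x \<in> inside B"
  shows "K \<subseteq> inside B"
proof
  fix y assume "y \<in> K"
  then have "connected_component (- B) x y"
    using assms connected_component_def by blast
  then show "y \<in> inside B"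
    using inside_same_component assms(4) by blast
qed

context
  fixes V :: "'v set" and \<phi> :: "'v \<Rightarrow> complex" and g
  assumes cd: "complete_drawing V \<phi> g"
begin

interpretation complete_drawing V \<phi> g by (rule cd)

text \<open>The theta-curve theorem for the three paths from \<open>u\<close> to \<open>v\<close>:
  the edge itself, the path through \<open>w\<close> and the path through \<open>d\<close>. As
  \<open>\<phi> d\<close> is inside the triangle \<open>u v w\<close>, the path through
  \<open>d\<close> is the one that divides this inside.\<close>

lemma chord_split:
  assumes V: "{u, v, w, d} \<subseteq> V" and dist: "distinct [u, v, w, d]"
    and d: "\<phi> d \<in> inside (E u v \<union> (E u w \<union> E w v))"
  obtains "inside (E u v \<union> (E u d \<union> E d v)) \<inter> inside ((E u w \<union> E w v) \<union> (E u d \<union> E d v)) = {}"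
    "inside (E u v \<union> (E u d \<union> E d v)) \<union> inside ((E u w \<union> E w v) \<union> (E u d \<union> E d v))
       \<union> ((E u d \<union> E d v) - {\<phi> u, \<phi> v}) = inside (E u v \<union> (E u w \<union> E w v))"
proof -
  have two: "simple_path (g u x +++ g x v)" "path_image (g u x +++ g x v) = E u x \<union> E x v"
    "pathstart (g u x +++ g x v) = \<phi> u" "pathfinish (g u x +++ g x v) = \<phi> v"
    if "x \<in> V" "x \<noteq> u" "x \<noteq> v" for x
  proof -
    have "path_image (g u x) \<inter> path_image (g x v) = {\<phi> x}"
      using E_meet[of x u v] E_sym[of x u] V dist that by (auto simp: E_def)
    then show "simple_path (g u x +++ g x v)"
      using V dist that arc by (intro arc_imp_simple_path arc_join) auto
  qed (use V dist that in \<open>auto simp: path_image_join E_def\<close>)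
  have meet: "E u x \<inter> E u y = {\<phi> u}" "E x v \<inter> E y v = {\<phi> v}" "E u x \<inter> E y v = {}"
    if "x \<in> V" "y \<in> V" "x \<noteq> u" "x \<noteq> v" "y \<noteq> u" "y \<noteq> v" "x \<noteq> y" for x y
    using E_meet[of u x y] E_meet[of v x y] E_disjoint[of u x y v] E_sym[of x v] E_sym[of y v] V dist that
    by auto
  have meet2: "E u v \<inter> E u x = {\<phi> u}" "E u v \<inter> E x v = {\<phi> v}" if "x \<in> V" "x \<noteq> u" "x \<noteq> v" for x
    using E_meet[of u v x] E_meet[of v u x] E_sym[of x v] E_sym[of u v] V dist that by auto
  have w: "w \<in> V" "w \<noteq> u" "w \<noteq> v" "w \<noteq> d" and d': "d \<in> V" "d \<noteq> u" "d \<noteq> v" "d \<noteq> w"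
    and uv: "u \<in> V" "v \<in> V" "u \<noteq> v"
    using V dist by auto
  have "simple_path (g u v)" using arc[OF uv] arc_imp_simple_path by auto
  note i = this start[OF uv] finish[OF uv] two(1,3,4)[OF w(1-3)] two(1,3,4)[OF d'(1-3)]
  have 1: "E u v \<inter> (E u w \<union> E w v) = {\<phi> u, \<phi> v}"
    by (simp only: Int_Un_distrib meet2[OF w(1-3)]) auto
  have 2: "E u v \<inter> (E u d \<union> E d v) = {\<phi> u, \<phi> v}"
    by (simp only: Int_Un_distrib meet2[OF d'(1-3)]) auto
  have "E w v \<inter> E u d = {}" using meet(3)[of d w] w d' by blast
  then have 3: "(E u w \<union> E w v) \<inter> (E u d \<union> E d v) = {\<phi> u, \<phi> v}"
    using meet[of w d] w d' by (simp only: Int_Un_distrib Int_Un_distrib2) auto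
  have 4: "(E u d \<union> E d v) \<inter> inside (E u v \<union> (E u w \<union> E w v)) \<noteq> {}"
    using d E_ends(2)[of u d] uv d' by blast
  have uv': "\<phi> u \<noteq> \<phi> v" using uv \<phi>_eq by simp
  note im = two(2)[OF w(1-3)] two(2)[OF d'(1-3)] E_def[of u v, symmetric]
  show thesis
    by (rule split_inside_simple_closed_curve[of "g u v" "\<phi> u" "\<phi> v" "g u w +++ g w v" "g u d +++ g d v",
          unfolded im, OF i uv' 1 2 3 4]) (fact that)
qed

text \<open>The set \<open>K\<close> could meet the boundary of the triangle \<open>u v d\<close>
  only at \<open>\<phi> d\<close>, which it omits. If it entered the inside, it would take
  \<open>\<phi> w\<close> along, hence put it inside the triangle \<open>u v w\<close>, of which it
  is a corner. The case \<open>x = e\<close> locates the vertex \<open>e\<close>, the case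
  \<open>x = d\<close> an edge leaving \<open>d\<close>.\<close>

lemma not_inside_subtriangle:
  assumes V: "{u, v, w, d, e} \<subseteq> V" and dist: "distinct [u, v, w, d, e]"
    and d: "\<phi> d \<in> inside (E u v \<union> (E u w \<union> E w v))"
    and x: "x \<in> {d, e}"
    and K: "connected K" "K \<subseteq> E x w" "\<phi> w \<in> K" "\<phi> d \<notin> K"
  shows "K \<inter> inside (E u v \<union> (E u d \<union> E d v)) = {}"
proof (rule ccontr)
  assume "\<not> ?thesis"
  then obtain y where y: "y \<in> K" "y \<in> inside (E u v \<union> (E u d \<union> E d v))" by blast
  have "E x w \<inter> (E u v \<union> (E u d \<union> E d v)) \<subseteq> {\<phi> d}"
    using E_disjoint[of x w u v] E_disjoint[of x w u d] E_disjoint[of x w d v]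
      E_meet[of d w u] E_meet[of d w v] E_sym[of u d] V dist x by auto
  then have "K \<inter> (E u v \<union> (E u d \<union> E d v)) = {}" using K by blast
  then have "\<phi> w \<in> inside (E u v \<union> (E u d \<union> E d v))"
    using connected_subset_inside[OF K(1) _ y] K by blast
  also have "\<dots> \<subseteq> inside (E u v \<union> (E u w \<union> E w v))"
    by (rule chord_split[of u v w d]) (use V dist d in auto)
  finally have "\<phi> w \<in> inside (E u v \<union> (E u w \<union> E w v))" .
  then show False
    using E_ends(2)[of u w] V dist by (simp add: inside_def)
qed

text \<open>The edge from \<open>d\<close> to \<open>e\<close> keeps \<open>e\<close> inside the
  triangle \<open>a b c\<close>. The edges at \<open>d\<close> cut this inside into three triangles,
  first along the path \<open>a d b\<close>, then along the edge \<open>d c\<close>. The vertex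
  \<open>e\<close> lies on none of these edges, and in none of the three triangles, because its edge
  to the opposite corner could not get out.\<close>

lemma no_K5_inside_triangle:
  assumes V: "{a, b, c, d, e} \<subseteq> V" and dist: "distinct [a, b, c, d, e]"
    and d: "\<phi> d \<in> inside (E a b \<union> (E a c \<union> E c b))"
  shows False
proof -
  let ?T = "E a b \<union> (E a c \<union> E c b)"
  have sym: "E a b = E b a" "E a c = E c a" "E b c = E c b" "E d a = E a d" "E d b = E b d" "E d c = E c d"
    using E_sym V dist by auto
  have "E d e \<inter> ?T = {}"
    using E_disjoint[of d e] V dist by auto
  then have eT: "\<phi> e \<in> inside ?T"
    using connected_subset_inside[OF E_connected[of d e] _ _ d] E_ends[of d e] V dist by auto
  have ne: "\<phi> e \<notin> inside (E u v \<union> (E u d \<union> E d v))"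
    if uvw: "{u, v, w} = {a, b, c}" "distinct [u, v, w]" and "\<phi> d \<in> inside (E u v \<union> (E u w \<union> E w v))" for u v w
  proof -
    have "u \<in> {a, b, c}" "v \<in> {a, b, c}" "w \<in> {a, b, c}" using uvw by blast+
    then have *: "{u, v, w, d, e} \<subseteq> V" "distinct [u, v, w, d, e]" using V dist uvw by auto
    then show ?thesis
      using not_inside_subtriangle[of u v w d e e "E e w"] E_connected[of e w] E_ends[of e w] E_vertex[of e w d]
        that by auto
  qed
  have ne1: "\<phi> e \<notin> inside (E a b \<union> (E a d \<union> E d b))"
    using ne[of a b c] d dist by auto
  have ne2: "\<phi> e \<notin> inside (E a c \<union> (E a d \<union> E d c))"
    using ne[of a c b] d dist sym by (auto simp: Un_ac)
  have ne3: "\<phi> e \<notin> inside (E b c \<union> (E b d \<union> E d c))"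
    using ne[of b c a] d dist sym by (auto simp: Un_ac)
  have nv: "\<phi> e \<notin> E a d" "\<phi> e \<notin> E d b" "\<phi> e \<notin> E d c"
    using E_vertex V dist by auto
  let ?I1 = "inside (E a b \<union> (E a d \<union> E d b))"
  let ?I2 = "inside ((E a c \<union> E c b) \<union> (E a d \<union> E d b))"
  have split: "?I1 \<union> ?I2 \<union> ((E a d \<union> E d b) - {\<phi> a, \<phi> b}) = inside ?T"
    by (rule chord_split[of a b c d]) (use V dist d in auto)
  have eI2: "\<phi> e \<in> ?I2" using split eT ne1 nv by blast
  \<comment> \<open>A finite connected set has at most one point, so the edge has a point
    \<open>y\<close> besides its ends. This \<open>y\<close> will witness that the edge runs through
    \<open>?I2\<close>, as the second use of the theta-curve theorem requires.\<close>
  have "E d c \<noteq> {\<phi> d, \<phi> c}"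
    using connected_finite_iff_sing[of "E d c"] E_connected[of d c] V dist \<phi>_eq[of d c] by auto
  then obtain y where y: "y \<in> E d c" "y \<noteq> \<phi> d" "y \<noteq> \<phi> c"
    using E_ends[of d c] V dist by auto
  have "(E d c - {\<phi> c}) \<inter> ?T = {}"
    using E_disjoint[of d c a b] E_meet[of c d a] E_meet[of c d b] V dist sym by auto
  then have "E d c - {\<phi> c} \<subseteq> inside ?T"
    using connected_subset_inside[OF E_minus_finish[of d c] _ _ d] E_ends[of d c] V dist \<phi>_eq[of d c] by auto
  then have "y \<in> inside ?T" using y by auto
  moreover have "y \<notin> E a d \<union> E d b"
    using y E_meet[of d c a] E_meet[of d c b] V dist sym by auto
  moreover have "y \<notin> ?I1"
    using not_inside_subtriangle[of a b c d e d "E d c - {\<phi> d}"] y d E_minus_start[of d c] E_ends[of d c]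
      V dist \<phi>_eq[of d c] by auto
  ultimately have yI2: "y \<in> ?I2" using split by auto
  \<comment> \<open>The quadrilateral with corners \<open>d\<close>, \<open>a\<close>,
    \<open>c\<close>, \<open>b\<close> bounds \<open>?I2\<close>; \<open>?A\<close> and
    \<open>?B\<close> are its two halves from \<open>d\<close> to \<open>c\<close>, and the edge
    \<open>d c\<close> is the chord that splits it.\<close>
  let ?A = "E d a \<union> E a c" and ?B = "E d b \<union> E b c"
  have two: "simple_path (g d x +++ g x c)" "path_image (g d x +++ g x c) = E d x \<union> E x c"
    "pathstart (g d x +++ g x c) = \<phi> d" "pathfinish (g d x +++ g x c) = \<phi> c"
    if "x \<in> {a, b}" for x
  proof -
    have "path_image (g d x) \<inter> path_image (g x c) = {\<phi> x}"
      using E_meet[of x d c] E_sym[of x d] V dist that by (auto simp: E_def)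
    then show "simple_path (g d x +++ g x c)"
      using V dist that arc by (intro arc_imp_simple_path arc_join) auto
  qed (use V dist that in \<open>auto simp: path_image_join E_def\<close>)
  have "E d a \<inter> E d b = {\<phi> d}" "E d a \<inter> E d c = {\<phi> d}" "E d b \<inter> E d c = {\<phi> d}"
    using E_meet[of d a b] E_meet[of d a c] E_meet[of d b c] V dist by auto
  moreover have "E a c \<inter> E b c = {\<phi> c}" "E a c \<inter> E d c = {\<phi> c}" "E b c \<inter> E d c = {\<phi> c}"
    using E_meet[of c a b] E_meet[of c a d] E_meet[of c b d] E_sym[of c a] E_sym[of c b] E_sym[of c d] V dist by auto
  moreover have "E d a \<inter> E b c = {}" "E a c \<inter> E d b = {}"
    using E_disjoint[of d a b c] E_disjoint[of a c d b] V dist by auto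
  ultimately have m: "?A \<inter> ?B = {\<phi> d, \<phi> c}" "?A \<inter> E d c = {\<phi> d, \<phi> c}" "?B \<inter> E d c = {\<phi> d, \<phi> c}"
    by (simp_all only: Int_Un_distrib Int_Un_distrib2) auto
  have AB: "?A \<union> ?B = (E a c \<union> E c b) \<union> (E a d \<union> E d b)" using sym by auto
  have dc: "d \<in> V" "c \<in> V" "d \<noteq> c" using V dist by auto
  have "E d c \<inter> inside (?A \<union> ?B) \<noteq> {}" using y(1) yI2 AB by auto
  have ab: "a \<in> {a, b}" "b \<in> {a, b}" by auto
  note im = two(2)[OF ab(1)] two(2)[OF ab(2)] E_def[of d c, symmetric]
  have "\<phi> d \<noteq> \<phi> c" using dc \<phi>_eq by simp
  note i = two(1,3,4)[OF ab(1)] two(1,3,4)[OF ab(2)]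
    arc_imp_simple_path[OF arc[OF dc]] start[OF dc] finish[OF dc] this m \<open>E d c \<inter> inside (?A \<union> ?B) \<noteq> {}\<close>
  have "inside (?A \<union> E d c) \<union> inside (?B \<union> E d c) \<union> (E d c - {\<phi> d, \<phi> c}) = inside (?A \<union> ?B)"
    by (rule split_inside_simple_closed_curve[of "g d a +++ g a c" "\<phi> d" "\<phi> c" "g d b +++ g b c" "g d c",
          unfolded im, OF i])
  then have "\<phi> e \<in> inside (?A \<union> E d c) \<union> inside (?B \<union> E d c)"
    using eI2 nv unfolding AB by blast
  moreover have "?A \<union> E d c = E a c \<union> (E a d \<union> E d c)" "?B \<union> E d c = E b c \<union> (E b d \<union> E d c)"
    using sym by auto
  ultimately show False using ne2 ne3 by simp
qed

end

section \<open>The sphere: choosing the centre of projection\<close>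

lemma punctured_sphere_homeomorphism:
  assumes "p \<in> sphere (0::real^3) 1"
  obtains h k where "homeomorphism (sphere 0 1 - {p}) (UNIV :: complex set) h k"
proof -
  have "sphere (0::real^3) 1 - {p} homeomorphic (UNIV :: complex set)"
    using homeomorphic_punctured_affine_sphere_affine[of 1 p 0 UNIV "UNIV :: complex set"] assms
    by (simp add: aff_dim_UNIV)
  then show thesis using that by (auto simp: homeomorphic_def)
qed

lemma closed_curve_compose:
  assumes h: "homeomorphism S T h k" and c: "simple_path c" "pathfinish c = pathstart c" "path_image c \<subseteq> S"
  shows "simple_path (h \<circ> c)" "pathfinish (h \<circ> c) = pathstart (h \<circ> c)" "path_image (h \<circ> c) = h ` path_image c"
proof -
  have "inj_on h S" "continuous_on S h"
    using h by (auto simp: homeomorphism_def inj_on_def) metis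
  then show "simple_path (h \<circ> c)"
    using c by (intro simple_path_continuous_image) (auto intro: inj_on_subset continuous_on_subset)
qed (use c in \<open>auto simp: pathfinish_compose pathstart_compose path_image_compose\<close>)

text \<open>Under stereographic projection from \<open>d\<close>, any point \<open>p\<close> of the bounded side of the curve will do.\<close>

lemma sphere_curve_separates:
  fixes c :: "real \<Rightarrow> real^3"
  assumes c: "simple_path c" "pathfinish c = pathstart c" "path_image c \<subseteq> sphere 0 1"
    and d: "d \<in> sphere 0 1" "d \<notin> path_image c"
  obtains p where "p \<in> sphere 0 1" "p \<notin> path_image c"
    "\<And>K. \<lbrakk>connected K; K \<subseteq> sphere 0 1 - path_image c; d \<in> K\<rbrakk> \<Longrightarrow> p \<notin> K"
proof -
  let ?S = "sphere (0::real^3) 1"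
  obtain h k where hk: "homeomorphism (?S - {d}) (UNIV :: complex set) h k"
    using punctured_sphere_homeomorphism d by blast
  have cS: "path_image c \<subseteq> ?S - {d}" using c d by auto
  note hc = closed_curve_compose[OF hk c(1,2) cS]
  let ?I = "inside (h ` path_image c)"
  have J: "?I \<noteq> {}" "open ?I" "bounded ?I"
    using Jordan_inside_outside[OF hc(1,2)] by (simp_all add: hc(3))
  have k_cont: "continuous_on UNIV k" and h_cont: "continuous_on (?S - {d}) h"
    and kS: "k ` UNIV = ?S - {d}" and hk_id: "\<And>y. h (k y) = y" "\<And>x. x \<in> ?S - {d} \<Longrightarrow> k (h x) = x"
    using hk by (auto simp: homeomorphism_def)
  obtain q where q: "q \<in> ?I" using J by blast
  have compact_C: "compact (path_image c)" using c simple_path_imp_path compact_path_image by blast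
  \<comment> \<open>Boundedness of the inside enters here: together with the curve it is compact, so
    its image under \<open>k\<close> is closed in the whole space and not merely in the punctured
    sphere.\<close>
  have "closed (h ` path_image c \<union> ?I)"
    using closed_path_image_Un_inside[OF simple_path_imp_path[OF hc(1)]] by (simp add: hc(3))
  moreover have "bounded (h ` path_image c)"
    using compact_imp_bounded compact_path_image simple_path_imp_path[OF hc(1)] hc(3) by metis
  ultimately have "compact (h ` path_image c \<union> ?I)"
    using J(3) by (simp add: compact_eq_bounded_closed)
  then have "compact (k ` (h ` path_image c \<union> ?I))"
    using k_cont by (intro compact_continuous_image) (auto intro: continuous_on_subset)
  then have cl: "closed (k ` (h ` path_image c \<union> ?I))" by (rule compact_imp_closed)
  have kh: "k ` h ` path_image c = path_image c"
    using hk_id(2) cS by (force simp: image_iff)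
  have disj: "k ` ?I \<inter> path_image c = {}"
  proof (rule ccontr)
    assume "\<not> ?thesis"
    then obtain y where "y \<in> ?I" "k y \<in> path_image c" by blast
    then have "y \<in> h ` path_image c" using hk_id(1)[of y] by (metis image_eqI)
    then show False using \<open>y \<in> ?I\<close> inside_no_overlap by blast
  qed
  have op: "openin (top_of_set ?S) (k ` ?I)"
  proof -
    have "k ` ?I = (?S - {d}) \<inter> h -` ?I"
    proof
      show "k ` ?I \<subseteq> (?S - {d}) \<inter> h -` ?I"
      proof
        fix x assume "x \<in> k ` ?I"
        then obtain y where y: "y \<in> ?I" "x = k y" by blast
        then show "x \<in> (?S - {d}) \<inter> h -` ?I" using kS hk_id(1)[of y] by blast
      qed
      show "(?S - {d}) \<inter> h -` ?I \<subseteq> k ` ?I"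
        using hk_id(2) by (metis IntE image_eqI subsetI vimageE)
    qed
    moreover have "openin (top_of_set (?S - {d})) ((?S - {d}) \<inter> h -` ?I)"
      using continuous_openin_preimage_gen[OF h_cont J(2)] .
    moreover have "openin (top_of_set ?S) (?S - {d})"
      by (simp add: openin_delete)
    ultimately show ?thesis using openin_trans by metis
  qed
  show thesis
  proof (rule that[of "k q"])
    show "k q \<in> ?S" using kS by blast
    show "k q \<notin> path_image c" using disj q by blast
    \<comment> \<open>Relative to \<open>K\<close> the region is open, and also closed, since adding
      the curve changes nothing on \<open>K\<close>. A connected \<open>K\<close> therefore lies in
      the region or misses it, and \<open>d\<close> is not in it.\<close>
    fix K assume K: "connected K" "K \<subseteq> ?S - path_image c" "d \<in> K"
    obtain T where T: "open T" "k ` ?I = ?S \<inter> T" using op unfolding openin_open by blast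
    then have "K \<inter> k ` ?I = K \<inter> T" using K(2) by blast
    then have "openin (top_of_set K) (K \<inter> k ` ?I)" using openin_open_Int[OF T(1)] by simp
    moreover have "K \<inter> k ` ?I = K \<inter> k ` (h ` path_image c \<union> ?I)"
      using K(2) kh by (auto simp: image_Un)
    then have "closedin (top_of_set K) (K \<inter> k ` ?I)"
      using closedin_closed_Int[OF cl, of K] by simp
    ultimately have "K \<inter> k ` ?I = {} \<or> K \<inter> k ` ?I = K"
      using K(1) connected_clopen by blast
    moreover have "d \<notin> k ` ?I" using kS by blast
    ultimately show "k q \<notin> K" using K(3) q by blast
  qed
qed

text \<open>If \<open>h d\<close> were outside, the preimage of the outside would be a connected set
  through \<open>d\<close> that avoids the curve. The outside is unbounded, so this set accumulates
  at the centre of projection \<open>p\<close>; adding \<open>p\<close> keeps it connected and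
  contradicts the separation of \<open>d\<close> from \<open>p\<close>.\<close>

lemma inside_of_separated:
  fixes c :: "real \<Rightarrow> real^3"
  assumes c: "simple_path c" "pathfinish c = pathstart c" "path_image c \<subseteq> sphere 0 1"
    and d: "d \<in> sphere 0 1" "d \<notin> path_image c"
    and p: "p \<in> sphere 0 1" "p \<notin> path_image c"
    and sep: "\<And>K. \<lbrakk>connected K; K \<subseteq> sphere 0 1 - path_image c; d \<in> K\<rbrakk> \<Longrightarrow> p \<notin> K"
    and hk: "homeomorphism (sphere 0 1 - {p}) (UNIV :: complex set) h k"
  shows "h d \<in> inside (h ` path_image c)"
proof (rule ccontr)
  assume out: "h d \<notin> inside (h ` path_image c)"
  let ?S = "sphere (0::real^3) 1"
  have cS: "path_image c \<subseteq> ?S - {p}" using c p by auto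
  note hc = closed_curve_compose[OF hk c(1,2) cS]
  let ?O = "outside (h ` path_image c)"
  have J: "connected ?O" "\<not> bounded ?O" "inside (h ` path_image c) \<union> ?O = - (h ` path_image c)"
    using Jordan_inside_outside[OF hc(1,2)] by (simp_all add: hc(3))
  have k_cont: "continuous_on UNIV k" and h_cont: "continuous_on (?S - {p}) h"
    and kS: "k ` UNIV = ?S - {p}" and hk_id: "\<And>y. h (k y) = y" "\<And>x. x \<in> ?S - {p} \<Longrightarrow> k (h x) = x"
    using hk by (auto simp: homeomorphism_def)
  have "d \<noteq> p" using sep[of "{d}"] d by auto
  then have dS: "d \<in> ?S - {p}" using d by auto
  have "h d \<notin> h ` path_image c"
  proof
    assume "h d \<in> h ` path_image c"
    then obtain x where "x \<in> path_image c" "h d = h x" by blast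
    then have "x \<in> ?S - {p}" using cS by blast
    then have "k (h x) = x" by (rule hk_id(2))
    moreover have "k (h d) = d" by (rule hk_id(2)[OF dS])
    ultimately have "d = x" using \<open>h d = h x\<close> by simp
    then show False using d \<open>x \<in> path_image c\<close> by simp
  qed
  then have "h d \<in> ?O" using out J(3) by blast
  then have dk: "d \<in> k ` ?O" using hk_id(2)[OF dS] by (metis image_eqI)
  have kO: "k ` ?O \<subseteq> ?S - path_image c"
  proof -
    have "k y \<notin> path_image c" if "y \<in> ?O" for y
    proof
      assume "k y \<in> path_image c"
      then have "y \<in> h ` path_image c" using hk_id(1)[of y] by (metis image_eqI)
      then show False using that outside_no_overlap by blast
    qed
    then show ?thesis using kS by blast
  qed
  \<comment> \<open>Were a ball around \<open>p\<close> missed, the outside would be contained in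
    the image of a compact set and hence be bounded.\<close>
  have "p \<in> closure (k ` ?O)"
  proof (rule ccontr)
    assume "p \<notin> closure (k ` ?O)"
    then obtain e where e: "e > 0" "ball p e \<inter> k ` ?O = {}"
      by (metis closure_approachable dist_commute disjoint_iff mem_ball)
    have "compact (?S - ball p e)" by (intro compact_diff) auto
    moreover have "?S - ball p e \<subseteq> ?S - {p}" using e(1) by auto
    ultimately have "bounded (h ` (?S - ball p e))"
      using h_cont by (intro compact_imp_bounded compact_continuous_image) (auto intro: continuous_on_subset)
    moreover have "?O \<subseteq> h ` (?S - ball p e)"
    proof
      fix y assume y: "y \<in> ?O"
      then have "k y \<in> ?S - ball p e" using e kS by blast
      then show "y \<in> h ` (?S - ball p e)" using hk_id(1)[of y] by (metis image_eqI)
    qed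
    ultimately show False using J(2) bounded_subset by blast
  qed
  then have "insert p (k ` ?O) \<subseteq> closure (k ` ?O)" using closure_subset[of "k ` ?O"] by simp
  moreover have "connected (k ` ?O)"
    by (intro connected_continuous_image J(1) continuous_on_subset[OF k_cont]) simp
  ultimately have "connected (insert p (k ` ?O))"
    using connected_intermediate_closure[of "k ` ?O" "insert p (k ` ?O)"] by blast
  then show False using sep[of "insert p (k ` ?O)"] kO dk p by auto
qed

text \<open>The point \<open>p\<close> from \<open>sphere_curve_separates\<close> avoids the
  triangle \<open>a b c\<close> by choice. It avoids all other edges because each of them, after
  deletion of its end on the triangle if it has one, is linked to \<open>d\<close> off the triangle.
  Projection from \<open>p\<close> thus carries the whole drawing to the plane, with
  \<open>d\<close> inside the triangle.\<close>

lemma no_K5_on_sphere: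
  fixes \<phi> :: "'v \<Rightarrow> real^3"
  assumes cd: "complete_drawing V \<phi> g"
    and V: "{a, b, c, d, e} = V" and dist: "distinct [a, b, c, d, e]"
    and S: "\<phi> ` V \<subseteq> sphere 0 1" "\<And>u v. \<lbrakk>u \<in> V; v \<in> V; u \<noteq> v\<rbrakk> \<Longrightarrow> path_image (g u v) \<subseteq> sphere 0 1"
  shows False
proof -
  interpret complete_drawing V \<phi> g by (rule cd)
  let ?S = "sphere (0::real^3) 1"
  have mem: "a \<in> V" "b \<in> V" "c \<in> V" "d \<in> V" "e \<in> V" using V by auto
  have ES: "E u v \<subseteq> ?S" if "u \<in> V" "v \<in> V" "u \<noteq> v" for u v using S(2) that by (simp add: E_def)
  let ?\<gamma> = "g a b +++ (g b c +++ g c a)"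
  let ?T = "E a b \<union> (E b c \<union> E c a)"
  have abc: "a \<noteq> b" "b \<noteq> c" "c \<noteq> a" using dist by auto
  have img: "path_image ?\<gamma> = ?T"
    using mem abc by (simp add: path_image_join E_def)
  have "E b c \<inter> E c a = {\<phi> c}" "E a b \<inter> E b c = {\<phi> b}" "E a b \<inter> E c a = {\<phi> a}"
    using E_meet[of c b a] E_meet[of b a c] E_meet[of a b c] E_sym[of b c] E_sym[of a b] E_sym[of a c] mem dist
    by auto
  then have simple: "simple_path ?\<gamma>"
    using mem abc arc
    by (intro simple_path_join_loop arc_join) (auto simp: path_image_join E_def)
  have closed: "pathfinish ?\<gamma> = pathstart ?\<gamma>" using mem abc by simp
  have TS: "path_image ?\<gamma> \<subseteq> ?S" unfolding img using ES mem dist by auto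
  have dS: "\<phi> d \<in> ?S" using S mem by auto
  have dT: "\<phi> d \<notin> path_image ?\<gamma>" unfolding img using E_vertex mem dist by auto
  obtain p where p: "p \<in> ?S" "p \<notin> path_image ?\<gamma>"
    and sep: "\<And>K. \<lbrakk>connected K; K \<subseteq> ?S - path_image ?\<gamma>; \<phi> d \<in> K\<rbrakk> \<Longrightarrow> p \<notin> K"
    using sphere_curve_separates[OF simple closed TS dS dT] by metis
  have pT: "p \<notin> E a b" "p \<notin> E b c" "p \<notin> E c a" using p img by auto
  have de: "E d e \<inter> ?T = {}" using E_disjoint[of d e] mem dist by auto
  have p_de: "p \<notin> E d e"
    using sep[of "E d e"] E_connected[of d e] E_ends(1)[of d e] ES[of d e] de mem dist unfolding img by auto
  have p_star: "p \<notin> E x v" if x: "x \<in> {d, e}" and v: "v \<in> {a, b, c}" for x v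
  proof
    assume px: "p \<in> E x v"
    have xv: "x \<in> V" "v \<in> V" "x \<noteq> v" using x v mem dist by auto
    have "E x v \<inter> ?T \<subseteq> {\<phi> v}"
    proof -
      have *: "E x v \<inter> E u w \<subseteq> {\<phi> v}" if "u \<in> {a, b, c}" "w \<in> {a, b, c}" "u \<noteq> w" for u w
      proof (cases "v = u \<or> v = w")
        case True
        then show ?thesis
          using E_meet[of v x u] E_meet[of v x w] E_sym[of x v] E_sym[of u w] that x v mem dist by auto
      next
        case False
        then show ?thesis using E_disjoint[of x v u w] that x v mem dist by auto
      qed
      show ?thesis using *[of a b] *[of b c] *[of c a] dist by auto
    qed
    moreover have "p \<noteq> \<phi> v"
      using pT E_ends[of a b] E_ends[of b c] mem dist v by auto
    \<comment> \<open>Adding the edge from \<open>d\<close> to \<open>e\<close> puts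
      \<open>d\<close> into the connected set also when \<open>x = e\<close>, so both cases are
      treated at once.\<close>
    moreover have "connected ((E x v - {\<phi> v}) \<union> E d e)"
      using E_minus_finish[OF xv] E_connected[of d e] E_ends[of d e] E_ends(1)[OF xv] \<phi>_eq[OF xv(1,2)] x xv(3) mem dist
      by (intro connected_Un) auto
    moreover have "\<phi> d \<in> E d e" using E_ends mem dist by auto
    ultimately show False
      using sep[of "(E x v - {\<phi> v}) \<union> E d e"] px ES[OF xv] ES[of d e] de mem dist unfolding img by auto
  qed
  have p_edge: "p \<notin> E u v" if uv: "u \<in> V" "v \<in> V" "u \<noteq> v" for u v
  proof -
    have "u \<in> {a, b, c, d, e}" "v \<in> {a, b, c, d, e}" using uv V by auto
    then have cases: "(u \<in> {a, b, c} \<and> v \<in> {a, b, c}) \<or> (u \<in> {d, e} \<and> v \<in> {a, b, c})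
        \<or> (u \<in> {a, b, c} \<and> v \<in> {d, e}) \<or> (u \<in> {d, e} \<and> v \<in> {d, e})" by blast
    have "p \<notin> E b a" "p \<notin> E c b" "p \<notin> E a c" "p \<notin> E e d"
      using pT p_de E_sym mem dist by auto
    moreover have "p \<notin> E v u" if "v \<in> {d, e}" "u \<in> {a, b, c}" using p_star that by blast
    ultimately show ?thesis using cases pT p_de p_star uv E_sym[OF uv] by auto
  qed
  obtain h k where hk: "homeomorphism (?S - {p}) (UNIV :: complex set) h k"
    using punctured_sphere_homeomorphism p by blast
  have "p \<noteq> \<phi> u" if "u \<in> V" for u
  proof -
    obtain v where "v \<in> V" "v \<noteq> u" using mem dist by (cases "u = a") auto
    then show ?thesis using p_edge[of u v] E_ends(1)[of u v] that by auto
  qed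
  then have VS: "\<phi> ` V \<subseteq> ?S - {p}" using S by auto
  have gS: "path_image (g u v) \<subseteq> ?S - {p}" if "u \<in> V" "v \<in> V" "u \<noteq> v" for u v
    using S(2)[OF that] p_edge[OF that] by (auto simp: E_def)
  have cd': "complete_drawing V (h \<circ> \<phi>) (\<lambda>u v. h \<circ> g u v)"
    by (rule transfer[OF hk VS gS])
  have "h (\<phi> d) \<in> inside (h ` ?T)"
    using inside_of_separated[OF simple closed TS dS dT p sep hk] unfolding img .
  moreover have E': "complete_drawing.E (\<lambda>u v. h \<circ> g u v) u v = h ` E u v" for u v
    by (simp add: complete_drawing.E_def[OF cd'] E_def path_image_compose)
  moreover have "?T = E a b \<union> (E a c \<union> E c b)"
    using E_sym mem dist by auto
  ultimately have "(h \<circ> \<phi>) d \<in> inside (complete_drawing.E (\<lambda>u v. h \<circ> g u v) a b \<union>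
      (complete_drawing.E (\<lambda>u v. h \<circ> g u v) a c \<union> complete_drawing.E (\<lambda>u v. h \<circ> g u v) c b))"
    by (simp add: E' image_Un)
  then show False
    using no_K5_inside_triangle[OF cd', of a b c d e] V dist by auto
qed

text \<open>Genus 0 gives a drawing on the unit sphere, and five vertices of a larger clique would
  restrict it to a drawing of the complete graph on five vertices.\<close>

lemma planar_graph_no_K5:
  assumes "planar_graph \<Gamma>"
    and F: "F \<subseteq> verts \<Gamma>" "\<And>x y. \<lbrakk>x \<in> F; y \<in> F; x \<noteq> y\<rbrakk> \<Longrightarrow> {x, y} \<in> edges \<Gamma>"
  shows "card F \<le> 4"
proof (rule ccontr)
  assume "\<not> card F \<le> 4"
  then obtain W where W: "W \<subseteq> F" "card W = 5"
    by (metis not_less_eq_eq numeral_nat(3) obtain_subset_with_card_n eval_nat_numeral(2,3) semiring_norm(26-28))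
  then obtain xs where xs: "set xs = W" "distinct xs" "length xs = 5"
    by (metis card.infinite distinct_card finite_distinct_list zero_neq_numeral)
  then obtain a b c d e where abcde: "xs = [a, b, c, d, e]"
    by (auto simp: length_Suc_conv numeral_eq_Suc)
  let ?S = "{enat n | n. \<exists>S. sphere_with_handles n S \<and> embeddable_on \<Gamma> S}"
  \<comment> \<open>The infimum of the empty set is infinite, so genus 0 makes \<open>?S\<close>
    nonempty; the infimum is then attained and 0 itself belongs to \<open>?S\<close>.\<close>
  have "?S \<noteq> {}"
  proof
    assume "?S = {}"
    then have "graph_genus \<Gamma> = \<infinity>" unfolding graph_genus_def by (simp only: Inf_enat_def) simp
    then show False using assms(1) by (simp add: planar_graph_def)
  qed
  then have "(LEAST n. n \<in> ?S) \<in> ?S" by (metis (no_types, lifting) LeastI all_not_in_conv)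
  then have "Inf ?S \<in> ?S" using \<open>?S \<noteq> {}\<close> by (simp only: Inf_enat_def if_False)
  then have "(0::enat) \<in> ?S" using assms(1) by (simp add: planar_graph_def graph_genus_def)
  then obtain S where S: "sphere_with_handles 0 S" "embeddable_on \<Gamma> S"
    by (auto simp: zero_enat_def)
  from S(1) have S_eq: "S = sphere 0 1" by (cases rule: sphere_with_handles.cases) auto
  from S(2) obtain \<phi> :: "'a \<Rightarrow> real^3" and \<gamma> where
    inj: "inj_on \<phi> (verts \<Gamma>)" and im: "\<phi> ` verts \<Gamma> \<subseteq> S"
    and edge: "\<And>e. e \<in> edges \<Gamma> \<Longrightarrow> arc (\<gamma> e) \<and> path_image (\<gamma> e) \<subseteq> S \<and>
           {pathstart (\<gamma> e), pathfinish (\<gamma> e)} = \<phi> ` e \<and> path_image (\<gamma> e) \<inter> \<phi> ` verts \<Gamma> = \<phi> ` e"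
    and cross: "\<And>e e'. \<lbrakk>e \<in> edges \<Gamma>; e' \<in> edges \<Gamma>; e \<noteq> e'\<rbrakk> \<Longrightarrow>
           path_image (\<gamma> e) \<inter> path_image (\<gamma> e') = \<phi> ` (e \<inter> e')"
    unfolding embeddable_on_def by metis
  \<comment> \<open>The embedding has one arc for each unordered edge, of unknown direction; it is
    reversed where it does not start at \<open>u\<close>.\<close>
  define g where "g u v = (if pathstart (\<gamma> {u, v}) = \<phi> u then \<gamma> {u, v} else reversepath (\<gamma> {u, v}))" for u v
  have gim: "path_image (g u v) = path_image (\<gamma> {u, v})" for u v by (simp add: g_def)
  have WV: "W \<subseteq> verts \<Gamma>" using W F by blast
  have We: "{u, v} \<in> edges \<Gamma>" if "u \<in> W" "v \<in> W" "u \<noteq> v" for u v using W F that by blast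
  have cd: "complete_drawing W \<phi> g"
  proof
    show "inj_on \<phi> W" using inj WV inj_on_subset by blast
    fix u v assume uv: "u \<in> W" "v \<in> W" "u \<noteq> v"
    note e = edge[OF We[OF uv]]
    show "arc (g u v)" using e by (simp add: g_def arc_reversepath)
    have ends: "{pathstart (\<gamma> {u, v}), pathfinish (\<gamma> {u, v})} = {\<phi> u, \<phi> v}" using e by simp
    have ne: "\<phi> u \<noteq> \<phi> v" using inj WV uv by (auto dest: inj_onD)
    show "pathstart (g u v) = \<phi> u" "pathfinish (g u v) = \<phi> v"
      using ends ne by (auto simp: g_def doubleton_eq_iff)
    show "path_image (g u v) = path_image (g v u)" by (simp add: gim insert_commute)
    have "path_image (g u v) \<inter> \<phi> ` W = (path_image (g u v) \<inter> \<phi> ` verts \<Gamma>) \<inter> \<phi> ` W" using WV by blast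
    also have "\<dots> = {\<phi> u, \<phi> v}" using e uv by (auto simp: gim)
    finally show "path_image (g u v) \<inter> \<phi> ` W = {\<phi> u, \<phi> v}" .
    fix w x assume "w \<in> W" "x \<in> W" "w \<noteq> x" "{u, v} \<noteq> {w, x}"
    then show "path_image (g u v) \<inter> path_image (g w x) = \<phi> ` ({u, v} \<inter> {w, x})"
      using cross We uv unfolding gim by blast
  qed
  show False
  proof (rule no_K5_on_sphere[OF cd])
    show "{a, b, c, d, e} = W" "distinct [a, b, c, d, e]" using xs abcde by auto
    show "\<phi> ` W \<subseteq> sphere 0 1" using im WV S_eq by blast
    show "path_image (g u v) \<subseteq> sphere 0 1" if "u \<in> W" "v \<in> W" "u \<noteq> v" for u v
      using edge[OF We[OF that]] S_eq by (simp add: gim)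
  qed
qed

section \<open>Conjugation in finite groups\<close>

context group
begin

definition conj_by :: "'a \<Rightarrow> 'a \<Rightarrow> 'a" where
  "conj_by g x = g \<otimes> x \<otimes> inv g"

text \<open>The acting set is a parameter: the carrier yields conjugacy classes, while a subgroup
  yields the orbits needed for counting modulo a prime.\<close>

definition conj_orbit :: "'a set \<Rightarrow> 'a \<Rightarrow> 'a set" where
  "conj_orbit S x = (\<lambda>g. conj_by g x) ` S"

definition centralizer :: "'a \<Rightarrow> 'a set" where
  "centralizer x = {g \<in> carrier G. g \<otimes> x = x \<otimes> g}"

lemma conj_by_closed [simp, intro]:
  "\<lbrakk>g \<in> carrier G; x \<in> carrier G\<rbrakk> \<Longrightarrow> conj_by g x \<in> carrier G"
  by (simp add: conj_by_def)

lemma conj_by_one [simp]: "x \<in> carrier G \<Longrightarrow> conj_by \<one> x = x"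
  by (simp add: conj_by_def)

lemma conj_by_of_one [simp]: "g \<in> carrier G \<Longrightarrow> conj_by g \<one> = \<one>"
  by (simp add: conj_by_def)

lemma conj_by_mult:
  "\<lbrakk>g \<in> carrier G; h \<in> carrier G; x \<in> carrier G\<rbrakk> \<Longrightarrow> conj_by (g \<otimes> h) x = conj_by g (conj_by h x)"
  by (simp add: conj_by_def inv_mult_group m_assoc)

lemma conj_by_of_mult:
  assumes "g \<in> carrier G" "x \<in> carrier G" "y \<in> carrier G"
  shows "conj_by g (x \<otimes> y) = conj_by g x \<otimes> conj_by g y"
proof -
  have "inv g \<otimes> (g \<otimes> (y \<otimes> inv g)) = y \<otimes> inv g"
    using assms by (simp add: m_assoc[symmetric])
  then show ?thesis using assms by (simp add: conj_by_def m_assoc)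
qed

lemma conj_by_of_pow:
  "\<lbrakk>g \<in> carrier G; x \<in> carrier G\<rbrakk> \<Longrightarrow> conj_by g (x [^] (n::nat)) = conj_by g x [^] n"
  by (induction n) (simp_all add: conj_by_of_mult)

lemma conj_by_inv_cancel [simp]:
  "\<lbrakk>g \<in> carrier G; x \<in> carrier G\<rbrakk> \<Longrightarrow> conj_by (inv g) (conj_by g x) = x"
  "\<lbrakk>g \<in> carrier G; x \<in> carrier G\<rbrakk> \<Longrightarrow> conj_by g (conj_by (inv g) x) = x"
  by (simp_all add: conj_by_mult[symmetric])

lemma conj_by_eq_iff:
  "\<lbrakk>g \<in> carrier G; x \<in> carrier G; y \<in> carrier G\<rbrakk> \<Longrightarrow> conj_by g x = conj_by g y \<longleftrightarrow> x = y"
  by (metis conj_by_inv_cancel(1))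

lemma conj_by_eq_one_iff [simp]:
  "\<lbrakk>g \<in> carrier G; x \<in> carrier G\<rbrakk> \<Longrightarrow> conj_by g x = \<one> \<longleftrightarrow> x = \<one>"
  by (metis conj_by_eq_iff conj_by_of_one one_closed)

lemma conj_by_of_inv:
  assumes "g \<in> carrier G" "x \<in> carrier G"
  shows "conj_by g (inv x) = inv (conj_by g x)"
proof -
  have "conj_by g (inv x) \<otimes> conj_by g x = \<one>"
    using assms by (simp add: conj_by_of_mult[symmetric])
  then show ?thesis using assms by (simp add: inv_equality)
qed

lemma conj_by_fixes_iff:
  assumes "g \<in> carrier G" "x \<in> carrier G"
  shows "conj_by g x = x \<longleftrightarrow> g \<in> centralizer x"
  using assms inv_solve_right'[of x "g \<otimes> x" g] by (auto simp: conj_by_def centralizer_def)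

lemma ord_conj_by:
  "\<lbrakk>g \<in> carrier G; x \<in> carrier G\<rbrakk> \<Longrightarrow> ord (conj_by g x) = ord x"
  by (simp add: ord_unique conj_by_of_pow[symmetric] pow_eq_id)

lemma centralizer_subset: "centralizer x \<subseteq> carrier G"
  by (auto simp: centralizer_def)

lemma centralizer_sym: "\<lbrakk>x \<in> carrier G; y \<in> centralizer x\<rbrakk> \<Longrightarrow> x \<in> centralizer y"
  by (auto simp: centralizer_def)

lemma centralizer_self: "x \<in> carrier G \<Longrightarrow> x \<in> centralizer x"
  by (auto simp: centralizer_def)

lemma subgroup_centralizer:
  assumes x: "x \<in> carrier G"
  shows "subgroup (centralizer x) G"
proof (rule subgroupI)
  show "centralizer x \<subseteq> carrier G" by (rule centralizer_subset)
  show "centralizer x \<noteq> {}" using centralizer_self[OF x] by (rule ex_in_conv[THEN iffD1, OF exI])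
next
  fix a assume a: "a \<in> centralizer x"
  then have aG: "a \<in> carrier G" using centralizer_subset by blast
  then have "conj_by a x = x" using a x conj_by_fixes_iff by simp
  then have "conj_by (inv a) x = x"
    using conj_by_inv_cancel(1)[of a x] aG x by simp
  then show "inv a \<in> centralizer x"
    using x aG by (simp add: conj_by_fixes_iff)
  fix b assume b: "b \<in> centralizer x"
  then have bG: "b \<in> carrier G" using centralizer_subset by blast
  then have "conj_by (a \<otimes> b) x = x"
    using b x aG \<open>conj_by a x = x\<close> conj_by_fixes_iff[of b x] by (simp add: conj_by_mult)
  then show "a \<otimes> b \<in> centralizer x"
    using x aG bG by (simp add: conj_by_fixes_iff)
qed

section \<open>Counting with orbits of conjugation\<close>

lemma card_conj_orbit:
  assumes fin: "finite (carrier G)" and S: "subgroup S G" and x: "x \<in> carrier G"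
  shows "card (conj_orbit S x) * card (S \<inter> centralizer x) = card S"
proof -
  interpret S: subgroup S G by (rule S)
  have finS: "finite S" using fin S.subset finite_subset by blast
  have fibre: "card {s \<in> S. conj_by s x = y} = card (S \<inter> centralizer x)"
    if y: "y \<in> conj_orbit S x" for y
  proof -
    obtain t where t: "t \<in> S" "y = conj_by t x" using y by (auto simp: conj_orbit_def)
    then have tG: "t \<in> carrier G" using S.subset by blast
    \<comment> \<open>The elements of \<open>S\<close> that send \<open>x\<close> to
      \<open>y\<close> form the left coset by \<open>t\<close> of the stabilizer
      \<open>S \<inter> centralizer x\<close>.\<close>
    have "bij_betw (\<lambda>c. t \<otimes> c) (S \<inter> centralizer x) {s \<in> S. conj_by s x = y}"
    proof (rule bij_betw_byWitness[where f' = "\<lambda>s. inv t \<otimes> s"])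
      show "\<forall>c\<in>S \<inter> centralizer x. inv t \<otimes> (t \<otimes> c) = c"
        using tG S.subset by (metis IntE inv_solve_left' m_closed subsetD)
      show "\<forall>s\<in>{s \<in> S. conj_by s x = y}. t \<otimes> (inv t \<otimes> s) = s"
        using tG S.subset by (metis (no_types, lifting) inv_closed inv_solve_left m_closed mem_Collect_eq subsetD)
      show "(\<lambda>s. inv t \<otimes> s) ` {s \<in> S. conj_by s x = y} \<subseteq> S \<inter> centralizer x"
      proof clarify
        fix s assume s: "s \<in> S" "y = conj_by s x"
        then have sG: "s \<in> carrier G" using S.subset by blast
        have "conj_by (inv t \<otimes> s) x = x"
          using s t tG sG x by (simp add: conj_by_mult flip: s(2))
        then show "inv t \<otimes> s \<in> S \<inter> centralizer x"
          using s t tG sG x conj_by_fixes_iff[of "inv t \<otimes> s" x] by simp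
      qed
      show "(\<lambda>c. t \<otimes> c) ` (S \<inter> centralizer x) \<subseteq> {s \<in> S. conj_by s x = y}"
      proof clarify
        fix c assume c: "c \<in> S" "c \<in> centralizer x"
        then have cG: "c \<in> carrier G" using S.subset by blast
        then have "conj_by c x = x" using c x conj_by_fixes_iff by simp
        then show "t \<otimes> c \<in> S \<and> conj_by (t \<otimes> c) x = y"
          using c t tG cG x by (simp add: conj_by_mult)
      qed
    qed
    then show ?thesis using bij_betw_same_card by fastforce
  qed
  have "card S = (\<Sum>y\<in>conj_orbit S x. card {s \<in> S. conj_by s x = y})"
    using sum.image_gen[OF finS, of "\<lambda>_. 1::nat" "\<lambda>g. conj_by g x"] by (simp add: conj_orbit_def)
  then show ?thesis using fibre by simp
qed

text \<open>As \<open>X\<close> is closed under the action, it is the disjoint union of its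
  orbits.\<close>

lemma dvd_card_if_dvd_orbits:
  assumes S: "subgroup S G" and X: "X \<subseteq> carrier G" "finite X"
    and closed: "\<And>s x. \<lbrakk>s \<in> S; x \<in> X\<rbrakk> \<Longrightarrow> conj_by s x \<in> X"
    and dvd: "\<And>x. x \<in> X \<Longrightarrow> k dvd card (conj_orbit S x)"
  shows "k dvd card X"
proof -
  interpret S: subgroup S G by (rule S)
  have eq: "conj_orbit S y = conj_orbit S x" if xy: "x \<in> X" "y \<in> conj_orbit S x" for x y
  proof -
    have *: "conj_orbit S y \<subseteq> conj_orbit S x" if xy: "x \<in> X" "y \<in> conj_orbit S x" for x y
    proof -
      obtain t where t: "t \<in> S" "y = conj_by t x" using xy by (auto simp: conj_orbit_def)
      show ?thesis
        unfolding conj_orbit_def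
      proof clarify
        fix s assume "s \<in> S"
        then have "conj_by s y = conj_by (s \<otimes> t) x"
          using t that X S.subset by (subst conj_by_mult) auto
        then show "conj_by s y \<in> (\<lambda>g. conj_by g x) ` S"
          using \<open>s \<in> S\<close> t by auto
      qed
    qed
    obtain t where t: "t \<in> S" "y = conj_by t x" using xy by (auto simp: conj_orbit_def)
    then have "x = conj_by (inv t) y" using that X S.subset by auto
    then have "x \<in> conj_orbit S y" using t by (auto simp: conj_orbit_def)
    moreover have "y \<in> X" using t closed that by auto
    ultimately show ?thesis using * that by blast
  qed
  have "x \<in> conj_orbit S x" if "x \<in> X" for x
    using that X by (auto simp: conj_orbit_def image_iff intro!: bexI[of _ \<one>])
  then have U: "\<Union> (conj_orbit S ` X) = X"
    using closed by (auto simp: conj_orbit_def)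
  have "k dvd card (\<Union> (conj_orbit S ` X))"
  proof (rule dvd_partition)
    show "\<forall>c1\<in>conj_orbit S ` X. \<forall>c2\<in>conj_orbit S ` X. c1 \<noteq> c2 \<longrightarrow> c1 \<inter> c2 = {}"
      using eq by blast
  qed (use X dvd U in auto)
  then show ?thesis by (simp only: U)
qed

text \<open>The fixed point congruence for a group of prime power order: every orbit of a nonfixed
  point has a size greater than 1 that divides \<open>p ^ n\<close>.\<close>

lemma prime_dvd_card_nonfixed:
  fixes p n :: nat
  assumes fin: "finite (carrier G)" and S: "subgroup S G" "card S = p ^ n" and p: "prime p"
    and X: "X \<subseteq> carrier G"
    and closed: "\<And>s x. \<lbrakk>s \<in> S; x \<in> X\<rbrakk> \<Longrightarrow> conj_by s x \<in> X"
  shows "p dvd card X - card {x \<in> X. S \<subseteq> centralizer x}"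
proof -
  interpret S: subgroup S G by (rule S)
  let ?F = "{x \<in> X. S \<subseteq> centralizer x}"
  have finX: "finite X" using fin X finite_subset by blast
  have "p dvd card (X - ?F)"
  proof (rule dvd_card_if_dvd_orbits[OF S(1)])
    fix s x assume s: "s \<in> S" and x: "x \<in> X - ?F"
    have xG: "x \<in> carrier G" and sG: "s \<in> carrier G" using x s X S.subset by auto
    show "conj_by s x \<in> X - ?F"
    proof -
      have "conj_by s x \<in> ?F \<Longrightarrow> x \<in> ?F"
      proof -
        assume *: "conj_by s x \<in> ?F"
        then have "inv s \<in> centralizer (conj_by s x)" using s by auto
        then have "conj_by (inv s) (conj_by s x) = conj_by s x"
          by (rule conj_by_fixes_iff[THEN iffD2, rotated 2]) (use sG xG in auto)
        then have "conj_by s x = x" using sG xG by simp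
        then show "x \<in> ?F" using * by simp
      qed
      then show ?thesis using x s closed by auto
    qed
  next
    fix x assume x: "x \<in> X - ?F"
    then have xG: "x \<in> carrier G" using X by auto
    note c = card_conj_orbit[OF fin S(1) xG]
    have "card (conj_orbit S x) \<noteq> 1"
    proof
      assume "card (conj_orbit S x) = 1"
      then have "card (S \<inter> centralizer x) = card S" using c by simp
      then have "S \<inter> centralizer x = S"
        using fin S.subset by (metis card_subset_eq finite_subset inf_le1)
      then show False using x by auto
    qed
    moreover have "card (conj_orbit S x) dvd p ^ n" using c S by (metis dvd_triv_left)
    ultimately show "p dvd card (conj_orbit S x)"
      using p divides_primepow_nat[OF p, of "card (conj_orbit S x)" n] by (auto simp: gr0_conv_Suc[symmetric] intro: dvd_power)
  qed (use X finX in auto)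
  moreover have "card (X - ?F) = card X - card ?F"
    using finX by (intro card_Diff_subset) auto
  ultimately show ?thesis by simp
qed

text \<open>Cauchy's theorem, from the Sylow theorem with exponent 1: in a subgroup of order
  \<open>p\<close> every element other than the identity has order \<open>p\<close>.\<close>

lemma exists_element_of_prime_order:
  fixes p :: nat
  assumes fin: "finite (carrier G)" and p: "prime p" "p dvd order G"
  shows "\<exists>x\<in>carrier G. ord x = p"
proof -
  obtain m where "order G = p * m" using p(2) by (rule dvdE)
  then have "order G = p ^ 1 * m" by simp
  from sylow_thm[OF p(1) is_group this fin] obtain H where H: "subgroup H G" "card H = p"
    by auto
  have "\<not> H \<subseteq> {\<one>}"
    using H p(1) card_mono[of "{\<one>}" H] prime_gt_1_nat[of p] by auto
  then obtain x where x: "x \<in> H" "x \<noteq> \<one>" by blast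
  interpret H: subgroup H G by (rule H)
  have xG: "x \<in> carrier G" using x H.subset by auto
  interpret HG: group "G\<lparr>carrier := H\<rparr>" by (rule subgroup_imp_group[OF H(1)])
  have "x [^]\<^bsub>G\<lparr>carrier := H\<rparr>\<^esub> order (G\<lparr>carrier := H\<rparr>) = \<one>"
    using HG.pow_order_eq_1[of x] x by simp
  then have "x [^] p = \<one>" using H by (simp add: order_def nat_pow_consistent[symmetric])
  then have "ord x dvd p" using xG pow_eq_id by blast
  moreover have "ord x \<noteq> 1" using xG x ord_eq_1 by blast
  ultimately show ?thesis using p(1) xG by (meson prime_nat_iff)
qed

section \<open>Cyclic subgroups and conjugacy classes\<close>

lemma generate_subset_centralizer:
  assumes "a \<in> carrier G" "y \<in> centralizer a"
  shows "generate G {a} \<subseteq> centralizer y"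
proof (rule generate_subgroup_incl)
  show "{a} \<subseteq> centralizer y" using centralizer_sym assms by simp
  show "subgroup (centralizer y) G" using assms centralizer_subset by (intro subgroup_centralizer) auto
qed

lemma generate_commutes:
  assumes "a \<in> carrier G" "x \<in> generate G {a}" "y \<in> centralizer a"
  shows "y \<in> centralizer x"
proof -
  have "x \<in> centralizer y" using generate_subset_centralizer[OF assms(1,3)] assms(2) by auto
  moreover have "y \<in> carrier G" using assms(3) centralizer_subset by auto
  ultimately show ?thesis by (rule centralizer_sym[rotated])
qed

lemma conj_orbit_self: "x \<in> carrier G \<Longrightarrow> x \<in> conj_orbit (carrier G) x"
  unfolding conj_orbit_def using conj_by_one[of x] by (metis image_eqI one_closed)

lemma conj_orbit_closed:
  assumes "x \<in> carrier G" "y \<in> conj_orbit (carrier G) x" "g \<in> carrier G"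
  shows "conj_by g y \<in> conj_orbit (carrier G) x"
proof -
  obtain h where "h \<in> carrier G" "y = conj_by h x" using assms(2) by (auto simp: conj_orbit_def)
  then have "conj_by g y = conj_by (g \<otimes> h) x" "g \<otimes> h \<in> carrier G"
    using assms by (simp_all add: conj_by_mult)
  then show ?thesis by (auto simp: conj_orbit_def)
qed

lemma conj_orbit_subset: "x \<in> carrier G \<Longrightarrow> conj_orbit (carrier G) x \<subseteq> carrier G"
  by (auto simp: conj_orbit_def)

lemma conj_orbit_ord: "\<lbrakk>x \<in> carrier G; y \<in> conj_orbit (carrier G) x\<rbrakk> \<Longrightarrow> ord y = ord x"
  by (auto simp: conj_orbit_def ord_conj_by)

lemma conj_orbit_disjoint:
  assumes "x \<in> carrier G" "y \<in> carrier G" "y \<notin> conj_orbit (carrier G) x"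
  shows "conj_orbit (carrier G) x \<inter> conj_orbit (carrier G) y = {}"
proof (rule ccontr)
  assume "\<not> ?thesis"
  then obtain z where z: "z \<in> conj_orbit (carrier G) x" "z \<in> conj_orbit (carrier G) y" by blast
  then obtain h where h: "h \<in> carrier G" "conj_by h y \<in> conj_orbit (carrier G) x"
    unfolding conj_orbit_def[of _ y] by blast
  then have "conj_by (inv h) (conj_by h y) \<in> conj_orbit (carrier G) x"
    using conj_orbit_closed[OF assms(1) h(2)] by simp
  then show False using assms h(1) by simp
qed

lemma subset_centralizer_abelian:
  assumes "A \<subseteq> carrier G" "\<And>a. a \<in> A \<Longrightarrow> A \<subseteq> centralizer a" "x \<in> A" "y \<in> A"
  shows "x \<otimes> y = y \<otimes> x"
  using assms(2)[OF assms(4)] assms(3) by (auto simp: centralizer_def)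

text \<open>An element that fixes all of \<open>T\<close> lies in all the centralizers
  \<open>{\<one>, q, inv q}\<close>, which have only the identity in common. A nontrivial
  \<open>k\<close> that fixed one \<open>q\<close> would be \<open>q\<close> or
  \<open>inv q\<close>, and then \<open>k \<otimes> k = inv k\<close> would centralize some
  \<open>q'\<close> that \<open>k\<close> inverts. So \<open>k\<close> inverts all of
  \<open>T\<close>, as do its conjugates; the product of two such elements fixes \<open>T\<close>,
  whence \<open>k\<close> equals its conjugates and is central.\<close>

lemma faithful_on_inverse_pairs:
  assumes T: "T \<subseteq> carrier G" "card T > 2"
    and T_conj: "\<And>g q. \<lbrakk>g \<in> carrier G; q \<in> T\<rbrakk> \<Longrightarrow> conj_by g q \<in> T"
    and T_ord: "\<And>q. q \<in> T \<Longrightarrow> q \<otimes> q = inv q \<and> inv q \<noteq> q"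
    and T_cent: "\<And>q. q \<in> T \<Longrightarrow> centralizer q = {\<one>, q, inv q}"
    and center: "\<And>k. \<lbrakk>k \<in> carrier G; \<And>g. g \<in> carrier G \<Longrightarrow> conj_by g k = k\<rbrakk> \<Longrightarrow> k = \<one>"
    and k: "k \<in> carrier G" "\<And>q. q \<in> T \<Longrightarrow> conj_by k q \<in> {q, inv q}"
  shows "k = \<one>"
proof (rule ccontr)
  assume k1: "k \<noteq> \<one>"
  have other: "\<exists>q'\<in>T. q' \<noteq> q \<and> q' \<noteq> inv q" for q
  proof (rule ccontr)
    assume "\<not> ?thesis"
    then have "T \<subseteq> {q, inv q}" by auto
    then have "card T \<le> card {q, inv q}" by (intro card_mono) auto
    also have "\<dots> \<le> 2" by (simp add: card_insert_if)
    finally show False using T(2) by simp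
  qed
  have TG: "q \<in> carrier G" if "q \<in> T" for q using T that by auto
  have inter: "m = \<one>" if m: "m \<in> carrier G" "\<And>q. q \<in> T \<Longrightarrow> conj_by m q = q" for m
  proof (rule ccontr)
    assume "m \<noteq> \<one>"
    then have *: "m = q \<or> m = inv q" if "q \<in> T" for q
      using m that TG conj_by_fixes_iff[of m q] T_cent[of q] by auto
    obtain q where q: "q \<in> T" using other by blast
    obtain q' where "q' \<in> T" "q' \<noteq> q" "q' \<noteq> inv q" using other by blast
    then show False using *[of q] *[of q'] q TG by (metis inv_inv)
  qed
  have inverts: "conj_by k q = inv q" if q: "q \<in> T" for q
  proof (rule ccontr)
    assume "conj_by k q \<noteq> inv q"
    then have "k \<in> centralizer q" using k q TG conj_by_fixes_iff by auto
    then have kq: "k = q \<or> k = inv q" using T_cent[OF q] k1 by auto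
    obtain q' where q': "q' \<in> T" "q' \<noteq> q" "q' \<noteq> inv q" using other by blast
    have nk: "k \<notin> centralizer q'" using T_cent[OF q'(1)] k1 kq q' q TG by (metis empty_iff insert_iff inv_inv)
    then have "conj_by k q' = inv q'"
      using k q' TG conj_by_fixes_iff by auto
    then have "conj_by (k \<otimes> k) q' = q'"
      using k q' TG by (simp add: conj_by_mult conj_by_of_inv)
    then have "k \<otimes> k \<in> centralizer q'" using k q' TG conj_by_fixes_iff by simp
    moreover have "k \<otimes> k = inv k"
      using kq T_ord[OF q] TG[OF q] by (metis inv_inv inv_mult_group)
    ultimately have "inv (inv k) \<in> centralizer q'"
      using subgroup.m_inv_closed[OF subgroup_centralizer[OF TG[OF q'(1)]]] by metis
    then show False using nk k by simp
  qed
  have "k \<otimes> k = \<one>"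
    using k inverts TG by (intro inter) (auto simp: conj_by_mult conj_by_of_inv)
  have "conj_by g k = k" if g: "g \<in> carrier G" for g
  proof -
    have inv': "conj_by (conj_by g k) q = inv q" if q: "q \<in> T" for q
    proof -
      have "conj_by (conj_by g k) q = conj_by g (conj_by k (conj_by (inv g) q))"
        using g k TG[OF q] by (simp add: conj_by_def[of g k] conj_by_mult)
      also have "\<dots> = conj_by g (inv (conj_by (inv g) q))"
        using inverts[OF T_conj[OF _ q, of "inv g"]] g by simp
      also have "\<dots> = inv q" using g TG[OF q] by (simp add: conj_by_of_inv)
      finally show ?thesis .
    qed
    have "conj_by g k \<otimes> k = \<one>"
      using k inverts TG g inv' by (intro inter) (auto simp: conj_by_mult conj_by_of_inv)
    then show ?thesis using \<open>k \<otimes> k = \<one>\<close> g k by (metis conj_by_closed right_cancel)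
  qed
  then show False using center k k1 by blast
qed

text \<open>The group permutes the four pairs \<open>{q, q\<inverse>}\<close> of elements of order 3 by conjugation.\<close>

lemma iso_sym_group_4:
  assumes fin: "finite (carrier G)" and order: "order G = 24"
    and T: "T \<subseteq> carrier G" "card T = 8"
    and T_conj: "\<And>g q. \<lbrakk>g \<in> carrier G; q \<in> T\<rbrakk> \<Longrightarrow> conj_by g q \<in> T"
    and T_inv: "\<And>q. q \<in> T \<Longrightarrow> inv q \<in> T"
    and T_ord: "\<And>q. q \<in> T \<Longrightarrow> q \<otimes> q = inv q \<and> inv q \<noteq> q"
    and T_cent: "\<And>q. q \<in> T \<Longrightarrow> centralizer q = {\<one>, q, inv q}"
    and center: "\<And>k. \<lbrakk>k \<in> carrier G; \<And>g. g \<in> carrier G \<Longrightarrow> conj_by g k = k\<rbrakk> \<Longrightarrow> k = \<one>"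
  shows "G \<cong> sym_group 4"
proof -
  define P where "P q = {q, inv q}" for q
  define X where "X = P ` T"
  define act where "act g A = conj_by g ` A" for g and A :: "'a set"
  have TG: "q \<in> carrier G" if "q \<in> T" for q using T that by auto
  have finT: "finite T" using fin T finite_subset by blast
  have XG: "A \<subseteq> carrier G" if "A \<in> X" for A using that TG by (auto simp: X_def P_def)
  have "2 * card X = card (\<Union> X)"
  proof (rule card_partition)
    have "P p = P q" if "q \<in> T" "p \<in> P q" for p q
      using that TG by (auto simp: P_def)
    then show "c1 \<inter> c2 = {}" if "c1 \<in> X" "c2 \<in> X" "c1 \<noteq> c2" for c1 c2
      using that unfolding X_def by blast
    show "card c = 2" if c: "c \<in> X" for c
    proof -
      obtain q where "q \<in> T" "c = {q, inv q}" using c by (auto simp: X_def P_def)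
      then show ?thesis using T_ord[of q] by auto
    qed
    show "finite (\<Union> X)" using finT by (auto simp: X_def P_def)
  qed (use finT in \<open>simp add: X_def\<close>)
  moreover have "\<Union> X = T" using T_inv by (auto simp: X_def P_def)
  ultimately have cardX: "card X = 4" using T by simp
  then have "finite X" using card.infinite by fastforce
  then obtain b where b: "bij_betw b {1..4::nat} X"
    using ex_bij_betw_nat_finite_1[of X] cardX by auto
  have act_P: "act g (P q) = P (conj_by g q)" if "g \<in> carrier G" "q \<in> T" for g q
    using that TG by (simp add: act_def P_def conj_by_of_inv)
  have act_X: "act g A \<in> X" if "g \<in> carrier G" "A \<in> X" for g A
    using that act_P T_conj by (auto simp: X_def)
  have act_mult: "act (g \<otimes> h) A = act g (act h A)" if "g \<in> carrier G" "h \<in> carrier G" "A \<in> X" for g h A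
    unfolding act_def image_image using that XG[OF that(3)] by (intro image_cong) (auto simp: conj_by_mult)
  have act_one: "act \<one> A = A" if "A \<in> X" for A
    unfolding act_def using XG[OF that] by force
  \<comment> \<open>The action on the pairs is carried over to \<open>{1..4}\<close> by the
    numbering \<open>b\<close>. Outside this set \<open>f g\<close> is the identity, as
    \<open>permutes\<close> demands.\<close>
  define f where "f g i = (if i \<in> {1..4} then inv_into {1..4} b (act g (b i)) else i)" for g and i :: nat
  have bX: "b i \<in> X" if "i \<in> {1..4}" for i using b that bij_betwE by blast
  have ib: "b (inv_into {1..4} b A) = A" "inv_into {1..4} b A \<in> {1..4}" if "A \<in> X" for A
    using b that by (auto simp: bij_betw_inv_into_right) (metis bij_betw_def inv_into_into atLeastAtMost_iff)+
  have bi: "inv_into {1..4} b (b i) = i" if "i \<in> {1..4}" for i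
    using b that by (rule bij_betw_inv_into_left)
  have f_eq: "f g i = inv_into {1..4} b (act g (b i))" if "i \<in> {1..4}" for g i
    using that by (simp add: f_def)
  have f_in: "f g i \<in> {1..4}" and b_f: "b (f g i) = act g (b i)" if "g \<in> carrier G" "i \<in> {1..4}" for g i
    using that ib act_X bX by (auto simp: f_def)
  have f_mult: "f (g \<otimes> h) = f g \<circ> f h" if "g \<in> carrier G" "h \<in> carrier G" for g h
  proof
    fix i
    show "f (g \<otimes> h) i = (f g \<circ> f h) i"
    proof (cases "i \<in> {1..4}")
      case True
      then have "f h i \<in> {1..4}" "b (f h i) = act h (b i)" using f_in b_f that by auto
      then have "f g (f h i) = inv_into {1..4} b (act (g \<otimes> h) (b i))"
        using act_mult[OF that bX[OF True]] by (simp only: f_eq)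
      then show ?thesis using True by (simp only: f_eq comp_apply)
    next
      case False
      then show ?thesis by (simp only: f_def comp_apply if_False)
    qed
  qed
  have f_one: "f \<one> = id"
  proof
    show "f \<one> i = id i" for i
      using act_one bX bi by (auto simp: f_def)
  qed
  have f_perm: "f g permutes {1..4}" if g: "g \<in> carrier G" for g
  proof (rule bij_imp_permutes)
    have "f g (f (inv g) i) = i" "f (inv g) (f g i) = i" for i
      using f_mult[of g "inv g"] f_mult[of "inv g" g] f_one g by (metis comp_apply id_apply r_inv l_inv inv_closed)+
    then show "bij_betw (f g) {1..4} {1..4}"
      using f_in[of g] f_in[of "inv g"] g by (intro bij_betw_byWitness[where f' = "f (inv g)"]) auto
  qed (auto simp: f_def)
  \<comment> \<open>An element acting as the identity preserves each pair, so
    \<open>faithful_on_inverse_pairs\<close> applies to it.\<close>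
  have ker: "k = \<one>" if k: "k \<in> carrier G" "f k = id" for k
  proof (rule faithful_on_inverse_pairs[OF T(1) _ T_conj T_ord T_cent center k(1)])
    fix q assume q: "q \<in> T"
    then have "P q \<in> X" by (simp add: X_def)
    then obtain i where i: "i \<in> {1..4}" "b i = P q" using b by (metis bij_betw_imp_surj_on imageE)
    then have "P (conj_by k q) = P q" using b_f[OF k(1) i(1)] k act_P[OF k(1) q] by simp
    then show "conj_by k q \<in> {q, inv q}" unfolding P_def by blast
  qed (use T in auto)
  have inj: "inj_on f (carrier G)"
  proof (rule inj_onI)
    fix g h assume gh: "g \<in> carrier G" "h \<in> carrier G" "f g = f h"
    then have "f (inv h \<otimes> g) = f (inv h \<otimes> h)" by (simp only: f_mult inv_closed)
    then have "inv h \<otimes> g = \<one>" using ker[of "inv h \<otimes> g"] gh f_one by simp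
    then show "g = h" using gh by (metis inv_equality inv_inv inv_closed)
  qed
  let ?S = "carrier (sym_group 4)"
  have sub: "f ` carrier G \<subseteq> ?S" using f_perm by (auto simp: sym_group_carrier)
  have "card ?S = 24" by (simp add: sym_group_card_carrier fact_numeral)
  moreover have "card (f ` carrier G) = 24" using card_image[OF inj] order by (simp add: order_def)
  \<comment> \<open>Both sides have 24 elements, so injectivity already gives surjectivity.\<close>
  ultimately have "f ` carrier G = ?S"
    using sub by (metis card_subset_eq card.infinite zero_neq_numeral)
  then have "f \<in> iso G (sym_group 4)"
    using inj f_mult by (auto simp: iso_def hom_def bij_betw_def sym_group_mult)
  then show ?thesis by (auto simp: is_iso_def)
qed

end

section \<open>Groups with few commuting elements\<close>

text \<open>Dividing out 3 and 5, each at most once, leaves a number without prime factors. The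
  lemma limits the index of the centralizer \<open>H\<close> below.\<close>

lemma odd_dvd_15_cases:
  fixes m :: nat
  assumes "m > 0" and p: "\<And>p. \<lbrakk>prime p; p dvd m\<rbrakk> \<Longrightarrow> p = 3 \<or> p = 5"
    and 9: "\<not> 9 dvd m" and 25: "\<not> 25 dvd m"
  shows "m \<in> {1, 3, 5, 15}"
proof -
  have split: "\<exists>n. (m = n \<or> m = q * n) \<and> \<not> q dvd n" if "\<not> q * q dvd m" for q m :: nat
  proof (cases "q dvd m")
    case True
    then obtain n where n: "m = q * n" by (rule dvdE)
    then have "\<not> q dvd n" using that by (auto intro: mult_dvd_mono)
    then show ?thesis using n by blast
  qed auto
  obtain n where n: "m = n \<or> m = 3 * n" "\<not> 3 dvd n" using split[of 3 m] 9 by auto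
  then have "\<not> 25 dvd n" using 25 by (auto intro: dvd_mult)
  then obtain k where k: "n = k \<or> n = 5 * k" "\<not> 5 dvd k" using split[of 5 n] by auto
  have "k = 1"
  proof (rule ccontr)
    assume "k \<noteq> 1"
    then obtain p' where p': "prime p'" "p' dvd k" using prime_factor_nat by blast
    have "k dvd m" using n k by auto
    then have "p' = 3 \<or> p' = 5" using p p' dvd_trans by blast
    moreover have "k dvd n" using k by auto
    ultimately show False using p' k n dvd_trans by blast
  qed
  then show ?thesis using n k by auto
qed

section \<open>Self-centralizing subgroups\<close>

locale small_commuting_sets = group G for G (structure) +
  assumes fin: "finite (carrier G)"
    and small: "\<And>F. \<lbrakk>F \<subseteq> carrier G; \<And>x y. \<lbrakk>x \<in> F; y \<in> F\<rbrakk> \<Longrightarrow> x \<otimes> y = y \<otimes> x\<rbrakk> \<Longrightarrow> card F \<le> 5"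
begin

text \<open>\<open>A\<close> and its coset by \<open>w\<close> together form a pairwise commuting
  set of twice the size. Consequently an abelian subgroup with at least three elements contains
  everything that commutes with it.\<close>

lemma abelian_extension:
  assumes A: "subgroup A G" "\<And>a. a \<in> A \<Longrightarrow> A \<subseteq> centralizer a"
    and w: "w \<in> carrier G" "w \<notin> A" "A \<subseteq> centralizer w"
  shows "2 * card A \<le> 5"
proof -
  interpret A: subgroup A G by (rule A)
  let ?F = "A \<union> (\<lambda>a. w \<otimes> a) ` A"
  have finA: "finite A" using fin A.subset finite_subset by blast
  have F: "?F \<subseteq> carrier G" using A.subset w by auto
  have step: "?F \<subseteq> centralizer c" if "c \<in> carrier G" "A \<subseteq> centralizer c" "w \<in> centralizer c" for c
    using that subgroup.m_closed[OF subgroup_centralizer[OF that(1)]] by auto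
  have Fa: "?F \<subseteq> centralizer a" if "a \<in> A" for a
    using that A.subset A(2) w centralizer_sym[of w a] by (intro step) auto
  have Fw: "?F \<subseteq> centralizer w"
    using w centralizer_self by (intro step) auto
  have "?F \<subseteq> centralizer c" if c: "c \<in> ?F" for c
  proof (rule step)
    show "c \<in> carrier G" using F c by blast
    show "w \<in> centralizer c"
      by (rule centralizer_sym[OF w(1)]) (use Fw c in auto)
    show "A \<subseteq> centralizer c"
    proof
      fix a assume a: "a \<in> A"
      show "a \<in> centralizer c"
        by (rule centralizer_sym) (use Fa[OF a] a c A.subset in auto)
    qed
  qed
  then have "card ?F \<le> 5" by (intro small[OF F] subset_centralizer_abelian[OF F])
  moreover have "card ((\<lambda>a. w \<otimes> a) ` A) = card A"
    using w A.subset by (intro card_image inj_onI) (auto dest: subsetD)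
  moreover have "A \<inter> (\<lambda>a. w \<otimes> a) ` A = {}"
  proof (rule ccontr)
    assume "\<not> ?thesis"
    then obtain a where a: "a \<in> A" "w \<otimes> a \<in> A" by blast
    then have "w \<otimes> a \<otimes> inv a \<in> A" by simp
    then show False using w a A.subset by (simp add: m_assoc)
  qed
  ultimately show ?thesis using finA by (simp add: card_Un_disjoint)
qed

text \<open>The elements \<open>\<one>\<close>, \<open>q\<close>, \<open>q \<otimes> q\<close> are
  distinct, so the cyclic subgroup of \<open>q\<close> is large enough for
  \<open>abelian_extension\<close> to exclude any further commuting element.\<close>

lemma centralizer_eq_generate:
  assumes q: "q \<in> carrier G" "q \<otimes> q \<noteq> \<one>"
  shows "centralizer q = generate G {q}"
proof
  let ?A = "generate G {q}"
  have sub: "subgroup ?A G" using q by (intro generate_is_subgroup) auto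
  have qA: "q \<in> ?A" by (simp add: generate.incl)
  have "{\<one>, q, q \<otimes> q} \<subseteq> ?A"
    using qA sub by (auto intro: generate.one generate.eng)
  moreover have "card {\<one>, q, q \<otimes> q} = 3"
    using q by (auto simp: card_insert_if)
  moreover have "finite ?A" using fin sub subgroup.subset finite_subset by blast
  ultimately have A3: "card ?A \<ge> 3" using card_mono by metis
  show "?A \<subseteq> centralizer q" using generate_subset_centralizer q centralizer_self by blast
  show "centralizer q \<subseteq> ?A"
  proof
    fix w assume w: "w \<in> centralizer q"
    then have wG: "w \<in> carrier G" using centralizer_subset by auto
    have "?A \<subseteq> centralizer a" if "a \<in> ?A" for a
      using generate_commutes[OF q(1) that] \<open>?A \<subseteq> centralizer q\<close> by blast
    moreover have "?A \<subseteq> centralizer w" by (rule generate_subset_centralizer[OF q(1) w])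
    ultimately show "w \<in> ?A" using abelian_extension[OF sub _ wG] A3 by fastforce
  qed
qed

lemma card_centralizer:
  "\<lbrakk>q \<in> carrier G; q \<otimes> q \<noteq> \<one>\<rbrakk> \<Longrightarrow> card (centralizer q) = ord q"
  by (simp add: centralizer_eq_generate generate_pow_card)

lemma ord_le_5:
  assumes q: "q \<in> carrier G"
  shows "ord q \<le> 5"
proof -
  have sub: "generate G {q} \<subseteq> carrier G" using q by (intro generate_incl) auto
  have "generate G {q} \<subseteq> centralizer q"
    using generate_subset_centralizer q centralizer_self by blast
  then have "generate G {q} \<subseteq> centralizer a" if "a \<in> generate G {q}" for a
    using generate_commutes[OF q that] by blast
  then have "card (generate G {q}) \<le> 5"
    by (intro small[OF sub] subset_centralizer_abelian[OF sub])
  then show ?thesis using generate_pow_card[OF q] by simp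
qed

lemma card_conj_orbit_ord:
  "\<lbrakk>q \<in> carrier G; q \<otimes> q \<noteq> \<one>\<rbrakk> \<Longrightarrow> card (conj_orbit (carrier G) q) * ord q = order G"
  using card_conj_orbit[OF fin subgroup_self, of q] card_centralizer[of q] centralizer_subset[of q]
  by (simp add: order_def Int_absorb1)

lemma ord_sq:
  assumes "q \<in> carrier G"
  shows "q \<otimes> q = \<one> \<longleftrightarrow> ord q dvd 2"
  using pow_eq_id[OF assms, of 2] assms by (simp add: numeral_2_eq_2)

text \<open>
  The cyclic group generated by \<open>q\<close> acts on the conjugacy class of \<open>q\<close> with the members of the class
  inside it as fixed points.
\<close>

lemma prime_dvd_class_diff:
  assumes q: "q \<in> carrier G" "ord q = p" and p: "prime p" "p > 2"
  shows "p dvd card (conj_orbit (carrier G) q) - card (conj_orbit (carrier G) q \<inter> generate G {q})"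
    and "\<not> p dvd card (conj_orbit (carrier G) q)"
proof -
  let ?C = "conj_orbit (carrier G) q" and ?A = "generate G {q}"
  have q2: "q \<otimes> q \<noteq> \<one>" using ord_sq[OF q(1)] q p by (auto dest: dvd_imp_le)
  have sub: "subgroup ?A G" using q by (intro generate_is_subgroup) auto
  have cardA: "card ?A = p" using generate_pow_card[OF q(1)] q by simp
  have AG: "?A \<subseteq> carrier G" using q by (intro generate_incl) auto
  have finA: "finite ?A" and finC: "finite ?C" using AG conj_orbit_subset[OF q(1)] fin finite_subset by blast+
  \<comment> \<open>The centralizer of \<open>q\<close> is \<open>?A\<close>, so the elements fixed
    by \<open>?A\<close> are exactly its members.\<close>
  have "{x \<in> ?C. ?A \<subseteq> centralizer x} = ?C \<inter> ?A"
  proof -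
    have "?A \<subseteq> centralizer x \<longleftrightarrow> x \<in> ?A" if "x \<in> carrier G" for x
    proof
      assume "?A \<subseteq> centralizer x"
      then have "q \<in> centralizer x" by (auto intro: generate.incl)
      then show "x \<in> ?A" using centralizer_sym[OF that] centralizer_eq_generate[OF q(1) q2] by blast
    next
      assume "x \<in> ?A"
      then have "x \<in> centralizer q" using centralizer_eq_generate[OF q(1) q2] by blast
      then show "?A \<subseteq> centralizer x" by (rule generate_subset_centralizer[OF q(1)])
    qed
    then show ?thesis using conj_orbit_subset[OF q(1)] by blast
  qed
  moreover have "p dvd card ?C - card {x \<in> ?C. ?A \<subseteq> centralizer x}"
    using prime_dvd_card_nonfixed[OF fin sub, of p 1 ?C] cardA p conj_orbit_closed[OF q(1)] conj_orbit_subset[OF q(1)] AG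
    by auto
  ultimately show *: "p dvd card ?C - card (?C \<inter> ?A)" by simp
  \<comment> \<open>The class meets \<open>?A\<close> in \<open>q\<close> and omits the identity, so
    the number of fixed points lies strictly between 0 and \<open>p\<close>.\<close>
  have "q \<in> ?C \<inter> ?A" using conj_orbit_self[OF q(1)] by (auto intro: generate.incl)
  then have "card (?C \<inter> ?A) > 0" using finC card_gt_0_iff by blast
  moreover have "\<one> \<notin> ?C"
  proof
    assume "\<one> \<in> ?C"
    then have "ord q = 1" using conj_orbit_ord[OF q(1)] by fastforce
    then show False using q p by simp
  qed
  then have "?C \<inter> ?A \<subset> ?A" using generate.one by blast
  then have "card (?C \<inter> ?A) < p" using finA cardA psubset_card_mono by metis
  ultimately have nd: "\<not> p dvd card (?C \<inter> ?A)" by (auto dest: dvd_imp_le)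
  have "card (?C \<inter> ?A) \<le> card ?C" using finC by (intro card_mono) auto
  then show "\<not> p dvd card ?C" using * nd by (metis dvd_diffD1)
qed

lemma ord_3_generate:
  assumes q: "q \<in> carrier G" "ord q = 3"
  shows "generate G {q} = {\<one>, q, inv q}" "q \<otimes> q = inv q" "inv q \<noteq> q" "q \<noteq> \<one>" "q \<otimes> q \<noteq> \<one>"
proof -
  show q2: "q \<otimes> q \<noteq> \<one>" using ord_sq[OF q(1)] q by auto
  show "q \<noteq> \<one>" using q2 by auto
  show i: "inv q \<noteq> q" using q q2 by (metis r_inv)
  have "q [^] (3::nat) = \<one>" using q pow_ord_eq_1 by metis
  then have "q \<otimes> q \<otimes> q = \<one>" using q by (simp add: numeral_3_eq_3)
  then show "q \<otimes> q = inv q" using q by (metis inv_equality m_closed)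
  have "{\<one>, q, inv q} \<subseteq> generate G {q}"
    by (auto intro: generate.one generate.incl generate.inv)
  moreover have "\<one> \<noteq> inv q" using \<open>q \<noteq> \<one>\<close> q by (metis inv_inv inv_one)
  then have "card {\<one>, q, inv q} = 3"
    using i \<open>q \<noteq> \<one>\<close> by (auto simp: card_insert_if)
  moreover have "finite (generate G {q})" using q fin generate_incl[of "{q}"] finite_subset by auto
  ultimately show "generate G {q} = {\<one>, q, inv q}"
    using generate_pow_card[OF q(1)] q(2) by (metis card_subset_eq)
qed

end

section \<open>A nonabelian centralizer: its order, its index, and the symmetric group\<close>

locale noncommuting_centralizer = small_commuting_sets +
  fixes x0 s1 s2
  assumes x0: "x0 \<in> carrier G" "x0 \<noteq> \<one>"
    and s1: "s1 \<in> centralizer x0" and s2: "s2 \<in> centralizer x0" and s12: "s1 \<otimes> s2 \<noteq> s2 \<otimes> s1"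
begin

abbreviation "H \<equiv> centralizer x0"
abbreviation "C \<equiv> conj_orbit (carrier G)"

lemma H_carrier: "s \<in> H \<Longrightarrow> s \<in> carrier G"
  using centralizer_subset by blast

text \<open>Otherwise the centralizer of \<open>x0\<close> would be cyclic, generated by
  \<open>x0\<close>, and \<open>s1\<close> and \<open>s2\<close> would commute.\<close>

lemma x0_involution: "x0 \<otimes> x0 = \<one>"
proof (rule ccontr)
  assume "x0 \<otimes> x0 \<noteq> \<one>"
  then have "s2 \<in> generate G {x0}" using centralizer_eq_generate x0 s2 by simp
  then have "s1 \<in> centralizer s2" using generate_commutes x0 s1 by blast
  then show False using s12 by (simp add: centralizer_def)
qed

lemma ord_x0: "ord x0 = 2"
proof -
  have "ord x0 dvd 2" using x0_involution ord_sq x0 by blast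
  moreover have "ord x0 \<noteq> 1" using x0 ord_eq_1 by blast
  ultimately show ?thesis by (metis prime_nat_iff two_is_prime_nat)
qed

text \<open>The involution \<open>x0\<close> commutes with \<open>s\<close> and so lies in the
  cyclic group of \<open>s\<close>. This makes the order of \<open>s\<close> even; it is at most 5
  and does not divide 2.\<close>

lemma ord_eq_4:
  assumes s: "s \<in> H" "s \<otimes> s \<noteq> \<one>"
  shows "ord s = 4"
proof -
  have sG: "s \<in> carrier G" using s H_carrier by blast
  have "x0 \<in> generate G {s}"
    using centralizer_eq_generate[OF sG s(2)] centralizer_sym[OF x0(1) s(1)] by simp
  moreover have "ord s \<noteq> 0" using ord_ge_1[OF fin sG] by simp
  ultimately obtain k :: nat where k: "x0 = s [^] k" using generate_pow_nat[OF sG] by auto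
  have "x0 [^] ord s = (s [^] ord s) [^] k"
    unfolding k using nat_pow_pow[OF sG] by (metis mult.commute)
  then have "x0 [^] ord s = \<one>" using pow_ord_eq_1[OF sG] by simp
  then have "2 dvd ord s" using pow_eq_id[OF x0(1)] ord_x0 by simp
  moreover have "ord s \<le> 5" by (rule ord_le_5[OF sG])
  moreover have "\<not> ord s dvd 2" using ord_sq[OF sG] s by simp
  ultimately show ?thesis using \<open>ord s \<noteq> 0\<close> by (auto elim!: dvdE)
qed

text \<open>If \<open>s\<close> is not an involution, its centralizer is cyclic of order 4 and
  contained in \<open>H\<close>. If it is one, then \<open>x0\<close> and \<open>s\<close> generate
  a Klein four-group, which by \<open>abelian_extension\<close> contains all elements commuting with
  both.\<close>

lemma card_H_Int_centralizer:
  assumes s: "s \<in> H" "s \<noteq> \<one>" "s \<noteq> x0"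
  shows "card (H \<inter> centralizer s) = 4"
proof (cases "s \<otimes> s = \<one>")
  case False
  have sG: "s \<in> carrier G" using s H_carrier by blast
  have "centralizer s = generate G {s}" using centralizer_eq_generate[OF sG False] .
  also have "\<dots> \<subseteq> H" using generate_subset_centralizer[OF sG] centralizer_sym[OF x0(1) s(1)] by blast
  finally have "H \<inter> centralizer s = centralizer s" by blast
  then show ?thesis using card_centralizer[OF sG False] ord_eq_4[OF s(1) False] by simp
next
  case True
  let ?A = "{\<one>, x0, s, s \<otimes> x0}"
  have sG: "s \<in> carrier G" using s H_carrier by blast
  have comm: "x0 \<otimes> s = s \<otimes> x0" using s by (simp add: centralizer_def)
  have cancel: "s \<otimes> (s \<otimes> x) = x" "x0 \<otimes> (x0 \<otimes> x) = x" "x0 \<otimes> (s \<otimes> x) = s \<otimes> (x0 \<otimes> x)"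
    if "x \<in> carrier G" for x
    using that True x0_involution comm sG x0 by (simp_all flip: m_assoc)
  have closed: "a \<otimes> b \<in> ?A" "a \<otimes> b = b \<otimes> a" if "a \<in> ?A" "b \<in> ?A" for a b
    using that True x0_involution comm cancel sG x0 by (auto simp: m_assoc)
  have AG: "?A \<subseteq> carrier G" using sG x0 by auto
  have inv: "inv a = a" if "a \<in> ?A" for a
    using that True x0_involution comm cancel sG x0 by (intro inv_equality) (auto simp: m_assoc)
  have sub: "subgroup ?A G"
    using AG closed(1) inv by (intro subgroupI) auto
  have cA: "?A \<subseteq> centralizer a" if "a \<in> ?A" for a
    using closed(2) that AG unfolding centralizer_def by blast
  have "s \<otimes> x0 \<noteq> \<one>"
    using s sG x0 x0_involution by (metis right_cancel)
  moreover have "s \<otimes> x0 \<noteq> x0" "s \<otimes> x0 \<noteq> s"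
    using s sG x0 by auto
  ultimately have card4: "card ?A = 4"
    using s x0 by (auto simp: card_insert_if)
  have "H \<inter> centralizer s \<subseteq> ?A"
  proof
    fix w assume w: "w \<in> H \<inter> centralizer s"
    then have wG: "w \<in> carrier G" using H_carrier by blast
    have "x0 \<in> centralizer w" "s \<in> centralizer w"
      using w x0 sG centralizer_sym by auto
    then have "?A \<subseteq> centralizer w"
      using subgroup.m_closed[OF subgroup_centralizer[OF wG]] subgroup.one_closed[OF subgroup_centralizer[OF wG]] by auto
    then show "w \<in> ?A"
      using abelian_extension[OF sub cA wG] card4 by fastforce
  qed
  moreover have "?A \<subseteq> H \<inter> centralizer s" using cA[of x0] cA[of s] by blast
  ultimately have "H \<inter> centralizer s = ?A" by (rule subset_antisym)
  then show ?thesis using card4 by simp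
qed

lemma s1_nontrivial: "s1 \<in> H" "s1 \<noteq> \<one>" "s1 \<noteq> x0"
proof -
  show "s1 \<in> H" by (rule s1)
  show "s1 \<noteq> \<one>" using s12 s2 H_carrier by auto
  show "s1 \<noteq> x0" using s12 s2 by (auto simp: centralizer_def)
qed

text \<open>All orbits of \<open>H\<close> on \<open>H - {\<one>, x0}\<close> have the same size
  \<open>k\<close>, and \<open>H\<close> has \<open>4 * k\<close> elements. Hence \<open>k\<close>
  divides \<open>4 * k - 2\<close> and therefore 2; the value 1 would make \<open>s1\<close> central
  in \<open>H\<close>.\<close>

lemma card_H: "card H = 8"
proof -
  have subH: "subgroup H G" using subgroup_centralizer x0 by blast
  have finH: "finite H" using fin centralizer_subset finite_subset by blast
  have x0H: "{\<one>, x0} \<subseteq> H" using x0 centralizer_self subgroup.one_closed[OF subH] by auto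
  have orb: "card (conj_orbit H s) * 4 = card H" if "s \<in> H - {\<one>, x0}" for s
    using card_conj_orbit[OF fin subH, of s] card_H_Int_centralizer[of s] that H_carrier by auto
  define k where "k = card (conj_orbit H s1)"
  have k: "card H = 4 * k" using orb[of s1] s1_nontrivial by (simp add: k_def)
  have "k dvd card (H - {\<one>, x0})"
  proof (rule dvd_card_if_dvd_orbits[OF subH])
    fix s x assume s: "s \<in> H" and x: "x \<in> H - {\<one>, x0}"
    have sG: "s \<in> carrier G" and xG: "x \<in> carrier G" using s x H_carrier by auto
    have "conj_by s x \<in> H"
      unfolding conj_by_def using s x subH by (simp add: subgroup.m_closed subgroup.m_inv_closed)
    moreover have "conj_by s x \<noteq> x0"
      using conj_by_eq_iff[OF sG xG x0(1)] conj_by_fixes_iff[OF sG x0(1)] s x by auto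
    ultimately show "conj_by s x \<in> H - {\<one>, x0}" using x sG xG by auto
  next
    fix x assume "x \<in> H - {\<one>, x0}"
    then show "k dvd card (conj_orbit H x)" using orb[of x] k by simp
  qed (use finH H_carrier in auto)
  moreover have "card (H - {\<one>, x0}) = 4 * k - 2"
    using card_Diff_subset[OF _ x0H] x0 k by auto
  moreover have "k > 0" using finH subgroup.one_closed[OF subH] k card_gt_0_iff[of H] by auto
  ultimately have kd: "k dvd 4 * k - 2" "k > 0" by auto
  \<comment> \<open>The subtraction is truncated, so \<open>k > 0\<close> is needed to recover
    \<open>4 * k\<close>.\<close>
  then have "4 * k - 2 + 2 = 4 * k" by simp
  then have "k dvd 4 * k - 2 + 2" by simp
  then have "k dvd 2" using kd(1) dvd_add_right_iff by blast
  then have "k \<le> 2" by (auto dest: dvd_imp_le)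
  moreover have "k \<noteq> 1"
  proof
    assume "k = 1"
    then have "card (H \<inter> centralizer s1) = card H" using card_H_Int_centralizer s1_nontrivial k by simp
    then have "H \<inter> centralizer s1 = H" using finH by (metis card_subset_eq inf_le1)
    then have "s2 \<in> centralizer s1" using s2 by blast
    then show False using s12 by (simp add: centralizer_def)
  qed
  ultimately show ?thesis using k kd(2) by auto
qed

lemma order_eq: "order G = 8 * card (C x0)"
  using card_conj_orbit[OF fin subgroup_self x0(1)] card_H centralizer_subset[of x0]
  by (simp add: order_def Int_absorb1)

text \<open>The 2-group \<open>H\<close> acts on the class of \<open>x0\<close>. A fixed point lies
  in \<open>H\<close> and is centralized by all eight elements of \<open>H\<close>, whereas elements
  of \<open>H\<close> other than \<open>\<one>\<close> and \<open>x0\<close> are centralized by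
  four; so \<open>x0\<close> is the only fixed point.\<close>

lemma odd_card_class: "odd (card (C x0))"
proof -
  have subH: "subgroup H G" using subgroup_centralizer x0 by blast
  have finC: "finite (C x0)" using fin conj_orbit_subset[OF x0(1)] finite_subset by blast
  have fixed: "{x \<in> C x0. H \<subseteq> centralizer x} = {x0}"
  proof
    show "{x0} \<subseteq> {x \<in> C x0. H \<subseteq> centralizer x}" using conj_orbit_self x0 by auto
    show "{x \<in> C x0. H \<subseteq> centralizer x} \<subseteq> {x0}"
    proof clarsimp
      fix x assume x: "x \<in> C x0" "H \<subseteq> centralizer x"
      have xG: "x \<in> carrier G" using x conj_orbit_subset x0 by blast
      have "x \<in> H" using x centralizer_self[OF x0(1)] centralizer_sym[OF xG] by blast
      moreover have "x \<noteq> \<one>" using conj_orbit_ord[OF x0(1) x(1)] ord_x0 by auto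
      moreover have "card (H \<inter> centralizer x) = 8" using x card_H by (simp add: Int_absorb2)
      ultimately show "x = x0" using card_H_Int_centralizer[of x] by fastforce
    qed
  qed
  have "2 dvd card (C x0) - card {x \<in> C x0. H \<subseteq> centralizer x}"
    using conj_orbit_subset[OF x0(1)] conj_orbit_closed[OF x0(1)] card_H H_carrier
    by (intro prime_dvd_card_nonfixed[OF fin subH, of 2 3]) auto
  moreover have "card (C x0) > 0" using finC conj_orbit_self[OF x0(1)] card_gt_0_iff by blast
  ultimately show ?thesis unfolding fixed by simp
qed

text \<open>A group in which every element is its own inverse is abelian, and \<open>H\<close> is
  not.\<close>

lemma exists_ord_4: "\<exists>y\<in>carrier G. ord y = 4"
proof -
  have "\<exists>s\<in>H. s \<otimes> s \<noteq> \<one>"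
  proof (rule ccontr)
    assume "\<not> ?thesis"
    then have inv: "inv s = s" if "s \<in> H" for s using that H_carrier by (simp add: inv_equality)
    have "s1 \<otimes> s2 \<in> H" using subgroup.m_closed[OF subgroup_centralizer[OF x0(1)]] s1 s2 by blast
    then have "inv (s1 \<otimes> s2) = s1 \<otimes> s2" by (rule inv)
    then show False using inv[OF s1] inv[OF s2] s12 inv_mult_group H_carrier s1 s2 by metis
  qed
  then show ?thesis using ord_eq_4 H_carrier by blast
qed

lemma prime_dvd_order: "\<lbrakk>prime p; p dvd order G\<rbrakk> \<Longrightarrow> p = 2 \<or> p = 3 \<or> p = 5"
proof -
  assume p: "prime p" "p dvd order G"
  then obtain x where "x \<in> carrier G" "ord x = p" using exists_element_of_prime_order[OF fin] by blast
  then have "p \<le> 5" using ord_le_5 by auto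
  moreover have "p \<noteq> 4" using p(1) by auto
  moreover have "p \<ge> 2" using p(1) prime_ge_2_nat by blast
  ultimately show ?thesis by presburger
qed

text \<open>For \<open>x\<close> of order \<open>p\<close> the class size times \<open>p\<close> is
  the group order, and the class size is prime to \<open>p\<close>.\<close>

lemma not_square_dvd_order:
  assumes p: "prime p" "p > 2"
  shows "\<not> p * p dvd order G"
proof
  assume *: "p * p dvd order G"
  then have "p dvd order G" using dvd_mult_left by blast
  then obtain x where x: "x \<in> carrier G" "ord x = p" using exists_element_of_prime_order[OF fin p(1)] by blast
  have "x \<otimes> x \<noteq> \<one>" using ord_sq[OF x(1)] x p by (auto dest: dvd_imp_le)
  then have "card (C x) * p = order G" using card_conj_orbit_ord x by auto
  then have "p * p dvd p * card (C x)" using * by (simp add: mult.commute)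
  then have "p dvd card (C x)" using p by simp
  then show False using prime_dvd_class_diff(2)[OF x p] by blast
qed

text \<open>Let \<open>m\<close> be the size of \<open>C x0\<close>. The group has
  \<open>8 * m\<close> elements, of which the class of \<open>x0\<close> takes \<open>m\<close> and
  the class of an element of order 4 takes \<open>2 * m\<close>.\<close>

lemma card_ord_3_le:
  assumes W: "W \<subseteq> carrier G" "\<And>w. w \<in> W \<Longrightarrow> ord w = 3"
  shows "card W \<le> 5 * card (C x0)"
proof -
  obtain y where y: "y \<in> carrier G" "ord y = 4" using exists_ord_4 by blast
  have "y \<otimes> y \<noteq> \<one>" using ord_sq[OF y(1)] y by auto
  then have "card (C y) * 4 = 8 * card (C x0)"
    using card_conj_orbit_ord[OF y(1)] y(2) order_eq by simp
  then have cy: "card (C y) = 2 * card (C x0)" by simp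
  have ox: "ord z = 2" if "z \<in> C x0" for z using conj_orbit_ord[OF x0(1) that] ord_x0 by simp
  have oy: "ord z = 4" if "z \<in> C y" for z using conj_orbit_ord[OF y(1) that] y by simp
  have sub: "C x0 \<subseteq> carrier G" "C y \<subseteq> carrier G" using conj_orbit_subset x0 y by auto
  then have finite: "finite (C x0)" "finite (C y)" "finite W"
    using W fin finite_subset by blast+
  have "C x0 \<inter> C y = {}" using ox oy by fastforce
  moreover have "(C x0 \<union> C y) \<inter> W = {}" using ox oy W(2) by fastforce
  ultimately have "card (C x0 \<union> C y \<union> W) = card (C x0) + card (C y) + card W"
    using finite by (simp add: card_Un_disjoint)
  moreover have "card (C x0 \<union> C y \<union> W) \<le> order G"
    unfolding order_def using sub W fin by (intro card_mono) auto
  ultimately show ?thesis using cy order_eq by simp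
qed

text \<open>A class of elements of order 3 comprises a third of the group. Two of them would
  comprise two thirds, more than the five eighths allowed by \<open>card_ord_3_le\<close>.\<close>

lemma ord_3_conjugate:
  assumes q: "q \<in> carrier G" "ord q = 3" and q': "q' \<in> carrier G" "ord q' = 3"
  shows "q' \<in> C q"
proof (rule ccontr)
  assume "q' \<notin> C q"
  then have disj: "C q \<inter> C q' = {}" using conj_orbit_disjoint q q' by blast
  have sub: "C q \<subseteq> carrier G" "C q' \<subseteq> carrier G" using conj_orbit_subset q q' by auto
  then have finite: "finite (C q)" "finite (C q')" using fin finite_subset by blast+
  have c: "card (C q) * 3 = 8 * card (C x0)" "card (C q') * 3 = 8 * card (C x0)"
    using card_conj_orbit_ord[OF q(1) ord_3_generate(5)[OF q]] card_conj_orbit_ord[OF q'(1) ord_3_generate(5)[OF q']]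
      q q' order_eq by auto
  have "ord w = 3" if "w \<in> C q \<union> C q'" for w
    using that conj_orbit_ord[OF q(1), of w] conj_orbit_ord[OF q'(1), of w] q q' by auto
  then have "card (C q \<union> C q') \<le> 5 * card (C x0)"
    using sub by (intro card_ord_3_le) auto
  then have "card (C q) + card (C q') \<le> 5 * card (C x0)"
    using disj finite by (simp add: card_Un_disjoint)
  moreover have "card (C x0) > 0"
    using odd_card_class by (simp add: odd_pos)
  ultimately show False using c by linarith
qed

text \<open>Since \<open>q\<close> and \<open>inv q\<close> are conjugate, the cyclic group of
  \<open>q\<close> fixes exactly these two members of the class.\<close>

lemma three_dvd_class:
  assumes q: "q \<in> carrier G" "ord q = 3"
  shows "3 dvd card (C q) - 2"
proof -
  note g = ord_3_generate[OF q]
  have "ord (inv q) = 3" using q ord_inv by simp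
  then have "inv q \<in> C q" using ord_3_conjugate q by simp
  moreover have "\<one> \<notin> C q" using conj_orbit_ord[OF q(1), of \<one>] q by auto
  ultimately have "C q \<inter> generate G {q} = {q, inv q}" using g(1) conj_orbit_self[OF q(1)] by auto
  moreover have "card {q, inv q} = 2" using g(3) by auto
  ultimately show ?thesis using prime_dvd_class_diff(1)[OF q] by simp
qed

text \<open>The residues \<open>n\<close> modulo 5 for which \<open>u [^] n\<close> is conjugate to
  \<open>u\<close> form a subgroup of the multiplicative group modulo 5, which has order 4; a
  subgroup of order 3 is impossible.\<close>

lemma card_class_fixed_ord_5:
  assumes u: "u \<in> carrier G" "ord u = 5"
  shows "card (C u \<inter> generate G {u}) \<noteq> 3"
proof -
  have pow_mod: "u [^] n = u [^] (n mod 5)" for n :: nat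
  proof -
    have "u [^] n = u [^] (5 * (n div 5)) \<otimes> u [^] (n mod 5)"
      using u by (simp add: nat_pow_mult)
    also have "u [^] (5 * (n div 5)) = \<one>"
      using pow_eq_id[OF u(1)] u(2) by simp
    finally show ?thesis using u by simp
  qed
  \<comment> \<open>Conjugating by the element that sends \<open>u\<close> to \<open>u [^] k\<close>
    multiplies exponents by \<open>k\<close>.\<close>
  have step: "u [^] (j * k) \<in> C u" if jk: "u [^] j \<in> C u" "u [^] k \<in> C u" for j k :: nat
  proof -
    obtain g where g: "g \<in> carrier G" "u [^] k = conj_by g u" using jk(2) by (auto simp: conj_orbit_def)
    have "conj_by g (u [^] j) = u [^] (j * k)"
      using g u by (simp add: conj_by_of_pow nat_pow_pow mult.commute flip: g(2))
    then show ?thesis using conj_orbit_closed[OF u(1) jk(1) g(1)] by simp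
  qed
  have gen: "u [^] n \<in> generate G {u}" for n :: nat
    using generate_pow_nat[OF u(1)] u(2) by auto
  have u1: "u [^] (1::nat) \<in> C u" using u conj_orbit_self by simp
  have finC: "finite (C u)" using fin conj_orbit_subset[OF u(1)] finite_subset by blast
  \<comment> \<open>Each of 2 and 3 generates the multiplicative group modulo 5. If neither occurs,
    only the exponents 1 and 4 remain.\<close>
  show ?thesis
  proof (cases "u [^] (2::nat) \<in> C u \<or> u [^] (3::nat) \<in> C u")
    case True
    have all: "u [^] (2::nat) \<in> C u \<and> u [^] (3::nat) \<in> C u \<and> u [^] (4::nat) \<in> C u"
    proof (cases "u [^] (2::nat) \<in> C u")
      case True
      then have "u [^] (4::nat) \<in> C u" using step[of 2 2] by simp
      moreover then have "u [^] (8::nat) \<in> C u" using step[of 4 2] True by simp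
      ultimately show ?thesis using True pow_mod[of 8] by simp
    next
      case False
      then have 3: "u [^] (3::nat) \<in> C u" using True by blast
      then have "u [^] (9::nat) \<in> C u" using step[of 3 3] by simp
      then have 4: "u [^] (4::nat) \<in> C u" using pow_mod[of 9] by simp
      then have "u [^] (12::nat) \<in> C u" using step[of 4 3] 3 by simp
      then show ?thesis using 3 4 pow_mod[of 12] by simp
    qed
    have "inj_on (\<lambda>n::nat. u [^] n) {1..4}"
      using ord_inj[OF u(1)] u(2) by (auto intro: inj_on_subset)
    then have "card ((\<lambda>n::nat. u [^] n) ` {1..4}) = 4" by (simp add: card_image)
    moreover have sub: "(\<lambda>n::nat. u [^] n) ` {1..4} \<subseteq> C u \<inter> generate G {u}"
    proof clarify
      fix n :: nat assume "n \<in> {1..4}"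
      then have "n = 1 \<or> n = 2 \<or> n = 3 \<or> n = 4" by auto
      then show "u [^] n \<in> C u \<inter> generate G {u}" using all u1 gen by blast
    qed
    moreover have "finite (C u \<inter> generate G {u})" using finC by blast
    then have "card ((\<lambda>n::nat. u [^] n) ` {1..4}) \<le> card (C u \<inter> generate G {u})"
      using sub by (rule card_mono)
    ultimately show ?thesis by linarith
  next
    case False
    have "C u \<inter> generate G {u} \<subseteq> {u [^] (1::nat), u [^] (4::nat)}"
    proof
      fix x assume x: "x \<in> C u \<inter> generate G {u}"
      then obtain n :: nat where "x = u [^] n" using generate_pow_nat[OF u(1)] u(2) by auto
      then have n: "x = u [^] (n mod 5)" using pow_mod by simp
      have "x \<noteq> \<one>" using conj_orbit_ord[OF u(1), of x] x u(2) by auto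
      moreover have "n mod 5 < 5" by simp
      then have "n mod 5 \<in> {0, 1, 2, 3, 4}" by auto
      ultimately show "x \<in> {u [^] (1::nat), u [^] (4::nat)}" using n False x by auto
    qed
    then have "card (C u \<inter> generate G {u}) \<le> card {u [^] (1::nat), u [^] (4::nat)}"
      by (intro card_mono) auto
    also have "\<dots> \<le> 2" by (simp add: card_insert_if)
    finally show ?thesis by simp
  qed
qed

text \<open>The index \<open>?m\<close> of \<open>H\<close> is odd, has no prime factor besides 3
  and 5, and neither square divides it. Excluding 1, 5 and 15 leaves the order 24.\<close>

lemma iso_sym_group_4_if_centerless:
  assumes center: "\<And>k. \<lbrakk>k \<in> carrier G; \<And>g. g \<in> carrier G \<Longrightarrow> conj_by g k = k\<rbrakk> \<Longrightarrow> k = \<one>"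
  shows "G \<cong> sym_group 4"
proof -
  let ?m = "card (C x0)"
  have m: "?m \<in> {1, 3, 5, 15}"
  proof (rule odd_dvd_15_cases)
    show "?m > 0" using odd_card_class by (simp add: odd_pos)
    fix p assume "prime p" "p dvd ?m"
    then show "p = 3 \<or> p = 5"
      using prime_dvd_order[of p] odd_card_class order_eq by auto
  next
    show "\<not> 9 dvd ?m" using not_square_dvd_order[of 3] order_eq by auto
    show "\<not> 25 dvd ?m" using not_square_dvd_order[of 5] order_eq by auto
  qed
  have "?m \<noteq> 1"
  proof
    assume "?m = 1"
    then have "C x0 = {x0}" using conj_orbit_self[OF x0(1)] by (metis card_1_singletonE singletonD)
    then have "conj_by g x0 = x0" if "g \<in> carrier G" for g using that by (auto simp: conj_orbit_def)
    then show False using center x0 by blast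
  qed
  \<comment> \<open>Here the order is 40 and the class of \<open>u\<close> has 8 elements, so the
    number of fixed points is 3 or 8. The cyclic group of \<open>u\<close> has only five elements,
    and 3 is excluded by \<open>card_class_fixed_ord_5\<close>.\<close>
  moreover have "?m \<noteq> 5"
  proof
    assume m5: "?m = 5"
    then obtain u where u: "u \<in> carrier G" "ord u = 5"
      using exists_element_of_prime_order[OF fin, of 5] order_eq by auto
    have "u \<otimes> u \<noteq> \<one>" using ord_sq[OF u(1)] u by auto
    then have c: "card (C u) = 8" using card_conj_orbit_ord[OF u(1)] u(2) order_eq m5 by simp
    let ?K = "C u \<inter> generate G {u}"
    have finC: "finite (C u)" using c card.infinite by fastforce
    have "card ?K \<le> card (C u)" using finC by (intro card_mono) auto
    moreover have "5 dvd 8 - card ?K" using prime_dvd_class_diff(1)[OF u] c by simp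
    moreover have "card ?K \<noteq> 8"
    proof
      assume "card ?K = 8"
      moreover have "finite (generate G {u})" using u fin generate_incl[of "{u}"] finite_subset by auto
      then have "card ?K \<le> card (generate G {u})" by (intro card_mono) auto
      ultimately show False using generate_pow_card[OF u(1)] u by simp
    qed
    ultimately have "card ?K = 3" unfolding c by presburger
    then show False using card_class_fixed_ord_5[OF u] by simp
  qed
  ultimately have m': "?m = 3 \<or> ?m = 15" using m by blast
  then have "3 dvd order G" using order_eq by auto
  then obtain q where q: "q \<in> carrier G" "ord q = 3"
    using exists_element_of_prime_order[OF fin, of 3] by auto
  have cq: "card (C q) * 3 = 8 * ?m"
    using card_conj_orbit_ord[OF q(1) ord_3_generate(5)[OF q]] q order_eq by simp
  \<comment> \<open>The class of \<open>q\<close> would have 40 elements, but 3 does not divide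
    38.\<close>
  have "?m \<noteq> 15"
  proof
    assume "?m = 15"
    then have "card (C q) = 40" using cq by simp
    then show False using three_dvd_class[OF q] by simp
  qed
  then have m3: "?m = 3" using m' by blast
  \<comment> \<open>All elements of order 3 are conjugate, so \<open>?T\<close> is a single class,
    of size 24 / 3.\<close>
  let ?T = "{x \<in> carrier G. ord x = 3}"
  have "?T = C q"
    using ord_3_conjugate[OF q] conj_orbit_ord[OF q(1)] conj_orbit_subset[OF q(1)] q by auto
  then have "card ?T = 8" using cq m3 by simp
  moreover have "centralizer x = {\<one>, x, inv x}" if "x \<in> ?T" for x
    using that centralizer_eq_generate[of x] ord_3_generate[of x] by auto
  ultimately show ?thesis
    using m3 order_eq ord_3_generate center
    by (intro iso_sym_group_4[OF fin, of ?T]) (auto simp: ord_conj_by)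
qed

end

text \<open>With trivial centre, a failure of transitivity at \<open>y\<close> is precisely a
  nonabelian centralizer. With nontrivial centre, \<open>x\<close> turns out to be a central
  multiple of \<open>y\<close> or \<open>inv y\<close>, hence commutes with everything that
  \<open>y\<close> commutes with.\<close>

theorem commuting_transitive_or_iso_sym_group_4:
  fixes G (structure)
  assumes G: "group G" and fin: "finite (carrier G)"
    and small: "\<And>F. \<lbrakk>F \<subseteq> carrier G - group_center G; \<And>x y. \<lbrakk>x \<in> F; y \<in> F\<rbrakk> \<Longrightarrow> x \<otimes> y = y \<otimes> x\<rbrakk> \<Longrightarrow> card F \<le> 4"
    and not_S4: "\<not> G \<cong> sym_group 4"
    and V: "x \<in> carrier G - group_center G" "y \<in> carrier G - group_center G" "w \<in> carrier G - group_center G"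
    and xy: "x \<otimes> y = y \<otimes> x" and yw: "y \<otimes> w = w \<otimes> y"
  shows "x \<otimes> w = w \<otimes> x"
proof -
  interpret group G by (rule G)
  let ?Z = "group_center G"
  have Z_iff: "z \<in> ?Z \<longleftrightarrow> z \<in> carrier G \<and> carrier G \<subseteq> centralizer z" for z
  proof -
    have "z \<otimes> g = g \<otimes> z \<longleftrightarrow> g \<otimes> z = z \<otimes> g" for g by (rule eq_commute)
    then show ?thesis unfolding group_center_def centralizer_def by blast
  qed
  have ZG: "?Z \<subseteq> carrier G" by (auto simp: group_center_def)
  have Z_comm: "c \<in> centralizer z" if "z \<in> ?Z" "c \<in> carrier G" for z c
    using that Z_iff by blast
  have Z_comm': "z \<in> centralizer c" if "z \<in> ?Z" "c \<in> carrier G" for z c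
    using centralizer_sym[OF _ Z_comm[OF that]] that ZG by blast
  have Z_mult: "z \<otimes> z' \<in> ?Z" "inv z \<in> ?Z" if "z \<in> ?Z" "z' \<in> ?Z" for z z'
  proof -
    have zG: "z \<in> carrier G" "z' \<in> carrier G" using that ZG by auto
    have "z \<otimes> z' \<in> centralizer c" "inv z \<in> centralizer c" if "c \<in> carrier G" for c
      using that Z_comm'[OF \<open>z \<in> ?Z\<close> that] Z_comm'[OF \<open>z' \<in> ?Z\<close> that] subgroup_centralizer[OF that]
      by (auto simp: subgroup.m_closed subgroup.m_inv_closed)
    then have "carrier G \<subseteq> centralizer (z \<otimes> z')" "carrier G \<subseteq> centralizer (inv z)"
      using centralizer_sym by blast+
    then show "z \<otimes> z' \<in> ?Z" "inv z \<in> ?Z" using zG Z_iff by auto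
  qed
  have one_Z: "\<one> \<in> ?Z" by (simp add: group_center_def)
  have G': "x \<in> carrier G" "y \<in> carrier G" "w \<in> carrier G" using V by auto
  have yx: "y \<in> centralizer x" "x \<in> centralizer y" and yw': "y \<in> centralizer w"
    using G' xy yw xy[symmetric] unfolding centralizer_def by blast+
  show ?thesis
  proof (cases "?Z = {\<one>}")
    case True
    show ?thesis
    proof (rule ccontr)
      assume ne: "x \<otimes> w \<noteq> w \<otimes> x"
      \<comment> \<open>The bound grows from 4 to 5 because the identity, the only central element,
        may belong to the set.\<close>
      have "small_commuting_sets G"
      proof
        show "finite (carrier G)" by (rule fin)
        fix F assume F: "F \<subseteq> carrier G" and comm: "\<And>x y. \<lbrakk>x \<in> F; y \<in> F\<rbrakk> \<Longrightarrow> x \<otimes> y = y \<otimes> x"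
        have "card (F - {\<one>}) \<le> 4"
        proof (rule small)
          show "F - {\<one>} \<subseteq> carrier G - group_center G" using F True by blast
        qed (use comm in blast)
        moreover have "finite F" using F fin finite_subset by blast
        ultimately show "card F \<le> 5" by (cases "\<one> \<in> F") (auto simp: card_Diff_singleton)
      qed
      then interpret small_commuting_sets G .
      \<comment> \<open>The middle element \<open>y\<close> plays the part of \<open>x0\<close>: it
        commutes with both \<open>x\<close> and \<open>w\<close>, which do not commute with each
        other.\<close>
      interpret noncommuting_centralizer G y x w
      proof
        show "y \<in> carrier G" by (rule G')
        show "y \<noteq> \<one>" using V(2) True by blast
        show "x \<in> centralizer y" by (rule yx)
        show "w \<in> centralizer y" by (rule centralizer_sym[OF G'(3) yw'])
        show "x \<otimes> w \<noteq> w \<otimes> x" by (rule ne)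
      qed
      have "G \<cong> sym_group 4"
      proof (rule iso_sym_group_4_if_centerless)
        fix k assume k: "k \<in> carrier G" "\<And>g. g \<in> carrier G \<Longrightarrow> conj_by g k = k"
        then have "k \<in> ?Z" using Z_iff conj_by_fixes_iff by blast
        then show "k = \<one>" using True by blast
      qed
      then show False using not_S4 by blast
    qed
  next
    case False
    then obtain z where z: "z \<in> ?Z" "z \<noteq> \<one>" using one_Z by blast
    have zG: "z \<in> carrier G" using z ZG by auto
    have "(\<exists>c\<in>?Z. y = c \<otimes> x) \<or> x \<otimes> y \<in> ?Z"
    proof (rule ccontr)
      assume no: "\<not> ?thesis"
      then have ncx: "y \<noteq> c \<otimes> x" if "c \<in> ?Z" for c using that by blast
      have nxy: "x \<otimes> y \<notin> ?Z" using no by blast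
      \<comment> \<open>Five pairwise commuting noncentral elements, two in the coset of
        \<open>x\<close>, two in that of \<open>y\<close> and one in that of
        \<open>x \<otimes> y\<close>. The negated claim makes them distinct and keeps
        \<open>x \<otimes> y\<close> out of the centre.\<close>
      let ?F = "{x, z \<otimes> x, y, z \<otimes> y, x \<otimes> y}"
      have "z \<otimes> a \<notin> ?Z" if a: "a \<in> carrier G - ?Z" for a
      proof
        assume "z \<otimes> a \<in> ?Z"
        then have "inv z \<otimes> (z \<otimes> a) \<in> ?Z" using Z_mult z by blast
        then show False using a zG by (simp flip: m_assoc)
      qed
      then have F: "?F \<subseteq> carrier G - ?Z" using V zG nxy by auto
      then have FG: "?F \<subseteq> carrier G" by blast
      have gen: "?F \<subseteq> centralizer c" if "c \<in> carrier G" "x \<in> centralizer c" "y \<in> centralizer c" "z \<in> centralizer c" for c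
        using that subgroup.m_closed[OF subgroup_centralizer[OF that(1)]] by blast
      have Fxyz: "?F \<subseteq> centralizer x" "?F \<subseteq> centralizer y" "?F \<subseteq> centralizer z"
        using gen G' zG yx centralizer_self Z_comm'[OF z(1)] Z_comm[OF z(1)] by metis+
      have "?F \<subseteq> centralizer c" if "c \<in> ?F" for c
        using that FG Fxyz by (intro gen centralizer_sym[of _ c] G' zG) blast+
      then have "card ?F \<le> 4" by (intro small[OF F] subset_centralizer_abelian[OF FG])
      moreover have "a \<noteq> z \<otimes> a" if "a \<in> carrier G" for a using that z zG by simp
      then have "x \<noteq> z \<otimes> x" "y \<noteq> z \<otimes> y" using G' by blast+
      moreover have "y \<noteq> x" using ncx[OF one_Z] G' by simp
      moreover have "y \<noteq> z \<otimes> x" by (rule ncx[OF z(1)])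
      moreover have "x \<noteq> z \<otimes> y"
      proof
        assume "x = z \<otimes> y"
        then have "inv z \<otimes> x = y" using zG G' by (simp flip: m_assoc)
        then show False using ncx[OF Z_mult(2)[OF z(1) z(1)]] by simp
      qed
      moreover have "z \<otimes> x \<noteq> z \<otimes> y" using zG G' \<open>y \<noteq> x\<close> by simp
      moreover have "x \<otimes> y \<noteq> x" "x \<otimes> y \<noteq> y" using G' V one_Z by auto
      moreover have "x \<otimes> y \<noteq> z \<otimes> y" using G' zG V z(1) by auto
      moreover have "x \<otimes> y \<noteq> z \<otimes> x" using xy G' zG V z(1) by auto
      ultimately show False using G' by (auto simp: card_insert_if split: if_splits)
    qed
    \<comment> \<open>In both cases \<open>x\<close> is a product of a central element with
      \<open>y\<close> or \<open>inv y\<close>, and both factors centralize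
      \<open>w\<close>.\<close>
    then have "x \<in> centralizer w"
    proof
      assume "\<exists>c\<in>?Z. y = c \<otimes> x"
      then obtain c where c: "c \<in> ?Z" "y = c \<otimes> x" by blast
      then have "x = inv c \<otimes> y" using G' ZG by (auto simp flip: m_assoc)
      moreover have "inv c \<in> centralizer w" using Z_comm' Z_mult c G' by blast
      ultimately show ?thesis using yw' subgroup.m_closed[OF subgroup_centralizer[OF G'(3)]] by simp
    next
      assume c: "x \<otimes> y \<in> ?Z"
      then have "x \<otimes> y \<in> centralizer w" using Z_comm' G' by blast
      moreover have "x = x \<otimes> y \<otimes> inv y" using G' by (simp add: m_assoc)
      moreover have "inv y \<in> centralizer w" using subgroup.m_inv_closed[OF subgroup_centralizer[OF G'(3)] yw'] .
      ultimately show ?thesis using subgroup.m_closed[OF subgroup_centralizer[OF G'(3)]] by metis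
    qed
    then show ?thesis by (simp add: centralizer_def)
  qed
qed

section \<open>Planar commuting graphs\<close>

lemma commuting_graph_edge_iff:
  "{x, y} \<in> edges (commuting_graph G) \<longleftrightarrow>
     x \<in> carrier G - group_center G \<and> y \<in> carrier G - group_center G \<and> x \<noteq> y \<and> x \<otimes>\<^bsub>G\<^esub> y = y \<otimes>\<^bsub>G\<^esub> x"
  (is "?edge \<longleftrightarrow> ?adj x y")
proof
  assume ?edge
  then obtain a b where "{x, y} = {a, b}" "?adj a b" unfolding commuting_graph_def by auto
  then show "?adj x y" by (metis doubleton_eq_iff)
next
  assume "?adj x y"
  then show ?edge unfolding commuting_graph_def by auto
qed

theorem theorem3p6:
  fixes G :: "('a, 'b) monoid_scheme"
  assumes "group G"
    and "finite (carrier G)"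
    and "\<not> comm_group G"
    and "\<not> G \<cong> sym_group 4"
    and "planar_graph (commuting_graph G)"
  shows "integral_graph (commuting_graph G)"
proof -
  have verts: "verts (commuting_graph G) = carrier G - group_center G"
    by (simp add: commuting_graph_def)
  \<comment> \<open>Pairwise commuting noncentral elements are pairwise adjacent, so they span a
    clique.\<close>
  have small: "card F \<le> 4"
    if "F \<subseteq> carrier G - group_center G" "\<And>x y. \<lbrakk>x \<in> F; y \<in> F\<rbrakk> \<Longrightarrow> x \<otimes>\<^bsub>G\<^esub> y = y \<otimes>\<^bsub>G\<^esub> x" for F
    using that by (intro planar_graph_no_K5[OF assms(5)]) (auto simp: verts commuting_graph_edge_iff)
  show ?thesis
  proof (rule integral_cluster_graph)
    show "finite (verts (commuting_graph G))" using assms(2) by (simp add: verts)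
    show "{x} \<notin> edges (commuting_graph G)" for x
      using commuting_graph_edge_iff[of x x G] by simp
    fix x y z
    assume xy: "{x, y} \<in> edges (commuting_graph G)" and yz: "{y, z} \<in> edges (commuting_graph G)"
      and "x \<noteq> z"
    note e = xy[unfolded commuting_graph_edge_iff] yz[unfolded commuting_graph_edge_iff]
    have "x \<otimes>\<^bsub>G\<^esub> z = z \<otimes>\<^bsub>G\<^esub> x"
      by (rule commuting_transitive_or_iso_sym_group_4[OF assms(1,2) small assms(4), of x y z]) (use e in blast)+
    then show "{x, z} \<in> edges (commuting_graph G)"
      unfolding commuting_graph_edge_iff using e \<open>x \<noteq> z\<close> by blast
  qed
qed

end
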